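(* Let $n\in\mathbb{N}$ and let $X$ be a nonempty set. The diagrammatic label algebra $\mathcal{L}_n(X)$ is generated by the diagrams $\widetilde{\mathrm{id}}$, $\tilde e_i$, $\tilde f^{ab}$, $\tilde f_{ab}$, $\tilde w^a_b$ and $\tilde v^a_b$, where $i=1,\dots,n-1$ and $a,b\in X$.
   Context: $\mathbb{N}$ is the set of positive integers. $X$ is a nonempty set of labels. The parameters $\beta$, $\alpha^{ab}$, $\delta_{ab}$, $\gamma^a_b$ ($a,b\in X$) are independent indeterminates and $K$ is the field of rational functions over $\mathbb{C}$ in them. **Diagrammatic label algebra $\mathcal{L}_n(X)$.** An $\mathcal{L}_n(X)$-diagram is a rectangle with $n$ nodes on its left side and $n$ on its right side, each numbered $1,\dots,n$ from top to bottom, and top and bottom sides called boundaries. Non-crossing strings are drawn inside the rectangle; each string connects a node to another node or to a boundary, each node has exactly one string endpoint attached, and each string endpoint on a boundary carries a label from $X$. Two diagrams are equal if their strings connect the same nodes to each other or to the same boundary, and corresponding boundary endpoints have the same labels. $\mathcal{L}_n(X)$ is the $K$-vector space with basis the set of $\mathcal{L}_n(X)$-diagrams. The product $D_1D_2$ of diagrams is defined by placing $D_1$ to the left of $D_2$ and joining right node $i$ of $D_1$ to left node $i$ of $D_2$ (concatenation), then removing each closed loop for a factor $\beta$ and each boundary arc (string with both ends on the boundaries) for a factor: $\alpha^{ab}$ if both ends are on top with labels $a$ (left), $b$ (right); $\delta_{ab}$ if both ends are on the bottom with labels $a$ (left), $b$ (right); $\gamma^a_b$ if it has a top end labelled $a$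 and a bottom end labelled $b$. Extend bilinearly. **Diagrammatic generators.** $\widetilde{\mathrm{id}}$: left $j$ joined to right $j$ for all $j$. $\tilde e_i$: left $i$ joined to left $i+1$, right $i$ to right $i+1$, left $j$ to right $j$ otherwise. $\tilde f^{ab}$: left $1$ joined to the top boundary with label $a$, right $1$ to the top with label $b$, left $j$ to right $j$ for $j\ge2$. $\tilde f_{ab}$: left $n$ joined to the bottom boundary with label $a$, right $n$ to the bottom with label $b$, left $j$ to right $j$ for $j\le n-1$. $\tilde w^a_b$: left $1$ joined to the top with label $a$, left $j$ to right $j-1$ for $2\le j\le n$, right $n$ to the bottom with label $b$. $\tilde v^a_b$: right $1$ joined to the top with label $a$, left $j$ to right $j+1$ for $1\le j\le n-1$, left $n$ to the bottom with label $b$. *)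

theory Defs
  imports Complex_Main "HOL-Library.Poly_Mapping" "HOL-Computational_Algebra.Fraction_Field"
begin

section \<open>The ground field\<close>

text \<open>The nonempty label set is the type \<open>'x\<close>.  The constructors below name the
  indeterminates beta, alpha^{ab}, delta_{ab} and gamma^a_b.\<close>

datatype 'x param = Beta | Alpha 'x 'x | Delta 'x 'x | Gamma 'x 'x

text \<open>An arbitrary linear order on the indeterminates.  It is there only because the library
  derives that polynomials over a domain form a domain from an order on the indeterminates;
  nothing below depends on which order it is.\<close>

instantiation param :: (type) linorder
begin

definition param_wo :: "'a param rel" where
  "param_wo = (SOME r. Well_order r \<and> Field r = UNIV)"

definition less_eq_param :: "'a param \<Rightarrow> 'a param \<Rightarrow> bool" where
  "less_eq_param p q \<longleftrightarrow> (p, q) \<in> param_wo"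

definition less_param :: "'a param \<Rightarrow> 'a param \<Rightarrow> bool" where
  "less_param p q \<longleftrightarrow> p \<le> q \<and> \<not> q \<le> p"

instance
proof
  have wo: "Well_order (param_wo :: 'a param rel) \<and> Field (param_wo :: 'a param rel) = UNIV"
    unfolding param_wo_def by (rule someI_ex) (rule well_ordering)
  then have "Linear_order (param_wo :: 'a param rel)"
    unfolding well_order_on_def by (elim conjE)
  then have lin: "linear_order (param_wo :: 'a param rel)"
    by (simp only: conjunct2[OF wo])
  then have "refl (param_wo :: 'a param rel)" and tr: "trans (param_wo :: 'a param rel)"
    and asym: "antisym (param_wo :: 'a param rel)" and tot: "total (param_wo :: 'a param rel)"
    by (simp_all only: order_on_defs)
  then have rf: "(p, p) \<in> param_wo" for p :: "'a param"
    by (simp add: refl_onD)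
  fix p q r :: "'a param"
  show "p < q \<longleftrightarrow> p \<le> q \<and> \<not> q \<le> p"
    by (rule less_param_def)
  show "p \<le> p"
    unfolding less_eq_param_def by (rule rf)
  show "p \<le> r" if "p \<le> q" "q \<le> r"
    using that unfolding less_eq_param_def by (rule transD[OF tr])
  show "p = q" if "p \<le> q" "q \<le> p"
    using that unfolding less_eq_param_def by (rule antisymD[OF asym])
  show "p \<le> q \<or> q \<le> p"
    unfolding less_eq_param_def
    using rf tot[unfolded total_on_def] by (metis UNIV_I)
qed

end

text \<open>Rational functions over the complex numbers in the indeterminates: a monomial is a
  finitely supported exponent function, a polynomial a finitely supported function on
  monomials.\<close>

type_synonym 'x ratfun = "(('x param \<Rightarrow>\<^sub>0 nat) \<Rightarrow>\<^sub>0 complex) fract"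

definition indet :: "'x param \<Rightarrow> 'x ratfun" where
  "indet p = Fract (Poly_Mapping.single (Poly_Mapping.single p 1) 1) 1"

section \<open>Diagrams\<close>

text \<open>The node \<open>Lf i\<close> is the left node i and \<open>Rt i\<close> the right node i.\<close>

datatype node = Lf nat | Rt nat

text \<open>What the string at a node leads to: another node, or a labelled endpoint on the top or
  on the bottom boundary.\<close>

datatype 'x target = ToNode node | ToTop 'x | ToBottom 'x

text \<open>A diagram is the map sending each of its nodes to the far end of the string there, so
  that equality of maps is equality of diagrams.\<close>

type_synonym 'x diagram = "node \<rightharpoonup> 'x target"

definition nodes :: "nat \<Rightarrow> node set" where
  "nodes n = Lf ` {1..n} \<union> Rt ` {1..n}"

text \<open>Position along the perimeter of the rectangle, run through counterclockwise from the
  top boundary: top boundary 0, left nodes 1, ..., n, bottom boundary n + 1, and then the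
  right nodes n, ..., 1.\<close>

fun pos :: "nat \<Rightarrow> node \<Rightarrow> nat" where
  "pos n (Lf i) = i"
| "pos n (Rt i) = 2 * n + 2 - i"

fun target_pos :: "nat \<Rightarrow> 'x target \<Rightarrow> nat" where
  "target_pos n (ToNode q) = pos n q"
| "target_pos n (ToTop a) = 0"
| "target_pos n (ToBottom b) = n + 1"

definition chords :: "nat \<Rightarrow> 'x diagram \<Rightarrow> (nat \<times> nat) set" where
  "chords n D = {(pos n p, target_pos n t) | p t. D p = Some t}"

text \<open>Strings can be drawn in the rectangle without crossing exactly if no two of them have
  interleaved ends on the perimeter.  Two strings ending on the same boundary are never
  forced to cross there, since their endpoints may be placed on it in either order; this is
  why all endpoints on one boundary share a position and the inequalities are strict.\<close>

definition noncrossing :: "nat \<Rightarrow> 'x diagram \<Rightarrow> bool" where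
  "noncrossing n D \<longleftrightarrow>
     (let R = chords n D \<union> (chords n D)\<inverse>
      in \<not> (\<exists>a b c d. (a, c) \<in> R \<and> (b, d) \<in> R \<and> a < b \<and> b < c \<and> c < d))"

definition diagrams :: "nat \<Rightarrow> 'x diagram set" where
  "diagrams n =
     {D. dom D = nodes n \<and>
         (\<forall>p q. D p = Some (ToNode q) \<longrightarrow> q \<noteq> p \<and> D q = Some (ToNode p)) \<and>
         noncrossing n D}"

section \<open>Concatenation\<close>

text \<open>The nodes of the concatenation of \<open>D\<close> (on the left) and \<open>E\<close> (on the right) are
  \<open>Inl p\<close> for the nodes p of \<open>D\<close> and \<open>Inr p\<close> for those of \<open>E\<close>.\<close>

type_synonym vertex = "node + node"

fun target_at :: "'x diagram \<Rightarrow> 'x diagram \<Rightarrow> vertex \<Rightarrow> 'x target option" where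
  "target_at D E (Inl p) = D p"
| "target_at D E (Inr p) = E p"

definition joins :: "nat \<Rightarrow> 'x diagram \<Rightarrow> 'x diagram \<Rightarrow> vertex rel" where
  "joins n D E =
     {(Inl (Rt i), Inr (Lf i)) | i. i \<in> {1..n}} \<union>
     {(Inl p, Inl q) | p q. D p = Some (ToNode q)} \<union>
     {(Inr p, Inr q) | p q. E p = Some (ToNode q)}"

text \<open>Two vertices are related if they lie on the same string of the concatenation.\<close>

definition connected_in :: "nat \<Rightarrow> 'x diagram \<Rightarrow> 'x diagram \<Rightarrow> vertex rel" where
  "connected_in n D E = (joins n D E \<union> (joins n D E)\<inverse>)\<^sup>*"

fun outer :: "node \<Rightarrow> vertex" where
  "outer (Lf i) = Inl (Lf i)"
| "outer (Rt i) = Inr (Rt i)"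

definition inner_vertices :: "nat \<Rightarrow> vertex set" where
  "inner_vertices n = (Inl \<circ> Rt) ` {1..n} \<union> (Inr \<circ> Lf) ` {1..n}"

fun leads_to :: "nat \<Rightarrow> 'x diagram \<Rightarrow> 'x diagram \<Rightarrow> node \<Rightarrow> 'x target \<Rightarrow> bool" where
  "leads_to n D E p (ToNode q) \<longleftrightarrow> q \<noteq> p \<and> (outer p, outer q) \<in> connected_in n D E"
| "leads_to n D E p (ToTop a) \<longleftrightarrow>
     (\<exists>v. (outer p, v) \<in> connected_in n D E \<and> target_at D E v = Some (ToTop a))"
| "leads_to n D E p (ToBottom b) \<longleftrightarrow>
     (\<exists>v. (outer p, v) \<in> connected_in n D E \<and> target_at D E v = Some (ToBottom b))"

text \<open>The diagram left after removal of closed loops and boundary arcs.\<close>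

definition concat_diagram :: "nat \<Rightarrow> 'x diagram \<Rightarrow> 'x diagram \<Rightarrow> 'x diagram" where
  "concat_diagram n D E =
     (\<lambda>p. if p \<in> nodes n then Some (THE t. leads_to n D E p t) else None)"

definition closed_loops :: "nat \<Rightarrow> 'x diagram \<Rightarrow> 'x diagram \<Rightarrow> vertex set set" where
  "closed_loops n D E =
     {C \<in> inner_vertices n // connected_in n D E.
        \<forall>v\<in>C. v \<in> inner_vertices n \<and> (\<exists>q. target_at D E v = Some (ToNode q))}"

text \<open>Boundary arcs are given by the two vertices whose strings run to the boundary, in the
  order in which the labels enter the factor.  As strings do not cross, in a single diagram
  the top endpoints occur from left to right in increasing order of the perimeter positions
  of the nodes they are joined to, and the bottom endpoints in decreasing order; in the
  concatenation all endpoints of the left factor lie to the left of those of the right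
  factor.\<close>

fun top_before :: "nat \<Rightarrow> vertex \<Rightarrow> vertex \<Rightarrow> bool" where
  "top_before n (Inl p) (Inl q) \<longleftrightarrow> pos n p < pos n q"
| "top_before n (Inl p) (Inr q) \<longleftrightarrow> True"
| "top_before n (Inr p) (Inl q) \<longleftrightarrow> False"
| "top_before n (Inr p) (Inr q) \<longleftrightarrow> pos n p < pos n q"

fun bottom_before :: "nat \<Rightarrow> vertex \<Rightarrow> vertex \<Rightarrow> bool" where
  "bottom_before n (Inl p) (Inl q) \<longleftrightarrow> pos n q < pos n p"
| "bottom_before n (Inl p) (Inr q) \<longleftrightarrow> True"
| "bottom_before n (Inr p) (Inl q) \<longleftrightarrow> False"
| "bottom_before n (Inr p) (Inr q) \<longleftrightarrow> pos n q < pos n p"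

text \<open>The last two arguments are what the strings at \<open>u\<close> and \<open>v\<close> lead to.  Exactly one of the
  two orderings of the end vertices of a boundary arc yields a parameter, so each arc is
  counted once below.\<close>

fun arc_param :: "nat \<Rightarrow> vertex \<Rightarrow> vertex \<Rightarrow> 'x target \<Rightarrow> 'x target \<Rightarrow> 'x param option" where
  "arc_param n u v (ToTop a) (ToTop b) = (if top_before n u v then Some (Alpha a b) else None)"
| "arc_param n u v (ToBottom a) (ToBottom b) =
     (if bottom_before n u v then Some (Delta a b) else None)"
| "arc_param n u v (ToTop a) (ToBottom b) = Some (Gamma a b)"
| "arc_param n u v _ _ = None"

definition boundary_arcs ::
  "nat \<Rightarrow> 'x diagram \<Rightarrow> 'x diagram \<Rightarrow> (vertex \<times> vertex \<times> 'x param) set" where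
  "boundary_arcs n D E =
     {(u, v, p). (u, v) \<in> connected_in n D E \<and>
        (\<exists>s t. target_at D E u = Some s \<and> target_at D E v = Some t \<and>
               arc_param n u v s t = Some p)}"

definition concat_factor :: "nat \<Rightarrow> 'x diagram \<Rightarrow> 'x diagram \<Rightarrow> 'x ratfun" where
  "concat_factor n D E =
     indet Beta ^ card (closed_loops n D E) * (\<Prod>(u, v, p)\<in>boundary_arcs n D E. indet p)"

section \<open>The diagrammatic label algebra\<close>

definition label_algebra :: "nat \<Rightarrow> ('x diagram \<Rightarrow>\<^sub>0 'x ratfun) set" where
  "label_algebra n = {f. Poly_Mapping.keys f \<subseteq> diagrams n}"

definition basis_elt :: "'x diagram \<Rightarrow> ('x diagram \<Rightarrow>\<^sub>0 'x ratfun)" where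
  "basis_elt D = Poly_Mapping.single D 1"

definition label_scale ::
  "'x ratfun \<Rightarrow> ('x diagram \<Rightarrow>\<^sub>0 'x ratfun) \<Rightarrow> ('x diagram \<Rightarrow>\<^sub>0 'x ratfun)" where
  "label_scale c f = Poly_Mapping.map ((*) c) f"

definition label_mult ::
  "nat \<Rightarrow> ('x diagram \<Rightarrow>\<^sub>0 'x ratfun) \<Rightarrow> ('x diagram \<Rightarrow>\<^sub>0 'x ratfun) \<Rightarrow> ('x diagram \<Rightarrow>\<^sub>0 'x ratfun)"
where
  "label_mult n f g =
     (\<Sum>D\<in>Poly_Mapping.keys f. \<Sum>E\<in>Poly_Mapping.keys g.
        Poly_Mapping.single (concat_diagram n D E)
          (Poly_Mapping.lookup f D * Poly_Mapping.lookup g E * concat_factor n D E))"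

text \<open>A subalgebra is not required to contain the identity; this makes no difference to the
  subalgebra generated by a set containing the identity diagram.\<close>

definition label_subalgebra :: "nat \<Rightarrow> ('x diagram \<Rightarrow>\<^sub>0 'x ratfun) set \<Rightarrow> bool" where
  "label_subalgebra n S \<longleftrightarrow>
     S \<subseteq> label_algebra n \<and> 0 \<in> S \<and>
     (\<forall>f\<in>S. \<forall>g\<in>S. f + g \<in> S) \<and>
     (\<forall>c. \<forall>f\<in>S. label_scale c f \<in> S) \<and>
     (\<forall>f\<in>S. \<forall>g\<in>S. label_mult n f g \<in> S)"

section \<open>The diagrammatic generators\<close>

definition id_diag :: "nat \<Rightarrow> 'x diagram" where
  "id_diag n = (\<lambda>p. if p \<in> nodes n
     then Some (case p of Lf j \<Rightarrow> ToNode (Rt j) | Rt j \<Rightarrow> ToNode (Lf j)) else None)"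

definition e_diag :: "nat \<Rightarrow> nat \<Rightarrow> 'x diagram" where
  "e_diag n i = (id_diag n)
     (Lf i \<mapsto> ToNode (Lf (i + 1)), Lf (i + 1) \<mapsto> ToNode (Lf i),
      Rt i \<mapsto> ToNode (Rt (i + 1)), Rt (i + 1) \<mapsto> ToNode (Rt i))"

definition f_top_diag :: "nat \<Rightarrow> 'x \<Rightarrow> 'x \<Rightarrow> 'x diagram" where
  "f_top_diag n a b = (id_diag n)(Lf 1 \<mapsto> ToTop a, Rt 1 \<mapsto> ToTop b)"

definition f_bottom_diag :: "nat \<Rightarrow> 'x \<Rightarrow> 'x \<Rightarrow> 'x diagram" where
  "f_bottom_diag n a b = (id_diag n)(Lf n \<mapsto> ToBottom a, Rt n \<mapsto> ToBottom b)"

definition w_diag :: "nat \<Rightarrow> 'x \<Rightarrow> 'x \<Rightarrow> 'x diagram" where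
  "w_diag n a b = (\<lambda>p. if p \<in> nodes n
     then Some (case p of
         Lf j \<Rightarrow> if j = 1 then ToTop a else ToNode (Rt (j - 1))
       | Rt j \<Rightarrow> if j = n then ToBottom b else ToNode (Lf (j + 1)))
     else None)"

definition v_diag :: "nat \<Rightarrow> 'x \<Rightarrow> 'x \<Rightarrow> 'x diagram" where
  "v_diag n a b = (\<lambda>p. if p \<in> nodes n
     then Some (case p of
         Lf j \<Rightarrow> if j = n then ToBottom b else ToNode (Rt (j + 1))
       | Rt j \<Rightarrow> if j = 1 then ToTop a else ToNode (Lf (j - 1)))
     else None)"

definition generator_diagrams :: "nat \<Rightarrow> 'x diagram set" where
  "generator_diagrams n =
     {id_diag n} \<union> {e_diag n i | i. 1 \<le> i \<and> i \<le> n - 1} \<union>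
     {f_top_diag n a b | a b. True} \<union> {f_bottom_diag n a b | a b. True} \<union>
     {w_diag n a b | a b. True} \<union> {v_diag n a b | a b. True}"

end

theory Submission
  imports Defs
begin

text \<open>Every factor \<open>concat_factor n D E\<close> is a product of indeterminates, hence a unit of the
  ground field, so it suffices that the closure of the generators under concatenation is the set
  of all diagrams.

  Concatenation preserves planarity because the other strings cannot pass from one side of a given
  string to the other, where the side of a vertex is a parity of the number of ends of the pieces
  of the given string.

  Conversely, a diagram is reduced by left multiplications that are undone by further left
  multiplications: an arc joining adjacent left nodes is moved up past node \<open>i\<close>
  (\<open>e (i + 1) e i D = D\<close>), an arc joining the first two left nodes becomes two strings to the top
  (\<open>e 1 f D = D\<close>), and a string from the last left node to the bottom becomes a string from the
  first one to the top (\<open>v w D = D\<close>). This leaves on the left only strings to the top and through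
  strings. A half turn, which reverses products and permutes the generators, lets us assume that
  on the right there are only strings to the bottom and through strings. By planarity the number
  of strings to the top and the labels determine such a diagram, and it is a product of diagrams
  \<open>w\<close>.\<close>

section \<open>Parity and positions\<close>

text \<open>The moves have to be identities between diagrams only: \<open>e 1 f D\<close>, for
  instance, is \<open>D\<close> times the parameter of a removed arc, and the field divides it out
  at the very end. All moves multiply on the left because a string of \<open>D\<close> that avoids
  its left nodes survives every left multiplication. So right nodes need no attention during a
  reduction, and a reduced right side, once reached by the half turn, stays reduced while the left
  side is treated again. An arc has to travel to the nodes 1 and 2 because a generator with a string
  from the left to the top has it at node 1. The measure is the number of left nodes joined to the
  top: moving an arc does not lower it, the two other moves raise it, and it is at most n.

  For planarity, the obstacle is that all endpoints on one boundary share a perimeter position, so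
  that a set of positions could lose ends. A string of the product that starts at an outer node has
  at most one end on the boundaries, which keeps the parities meaningful.\<close>

lemma even_card_involution:
  assumes "finite A"
    and "\<And>x. x \<in> A \<Longrightarrow> s x \<in> A \<and> s x \<noteq> x \<and> s (s x) = x"
  shows "even (card A)"
  using assms
proof (induction "card A" arbitrary: A rule: less_induct)
  case less
  show ?case
  proof (cases "A = {}")
    case False
    then obtain x where x: "x \<in> A" by blast
    let ?B = "A - {x, s x}"
    have sx: "s x \<in> A" "s x \<noteq> x" "s (s x) = x"
      using less.prems(2)[OF x] by auto
    have cA: "card A = card ?B + 2"
    proof -
      have "card {x, s x} = 2"
        using sx by (simp add: card_insert_if)
      moreover have "{x, s x} \<subseteq> A" using x sx by auto
      ultimately show ?thesis
        using less.prems(1) card_Diff_subset[of "{x, s x}" A] card_mono[of A "{x, s x}"]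
        by simp
    qed
    have "even (card ?B)"
    proof (rule less.hyps)
      show "card ?B < card A" using cA by simp
      show "finite ?B" using less.prems(1) by simp
      show "s y \<in> ?B \<and> s y \<noteq> y \<and> s (s y) = y" if "y \<in> ?B" for y
        using that less.prems(2)[of y] sx by auto
    qed
    then show ?thesis using cA by simp
  qed simp
qed

text \<open>Such a relation is the graph of an involution without fixed points. The relational form
  suits ends of strings, where partners are given by chords.\<close>

lemma even_card_matching:
  assumes "finite A" and "sym R"
    and "\<And>x. x \<in> A \<Longrightarrow> \<exists>y\<in>A. (x, y) \<in> R"
    and "\<And>x y z. x \<in> A \<Longrightarrow> (x, y) \<in> R \<Longrightarrow> (x, z) \<in> R \<Longrightarrow> y = z"
    and "\<And>x. x \<in> A \<Longrightarrow> (x, x) \<notin> R"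
  shows "even (card A)"
proof -
  obtain s where s: "\<And>x. x \<in> A \<Longrightarrow> s x \<in> A \<and> (x, s x) \<in> R"
    using assms(3) by metis
  have "s x \<in> A \<and> s x \<noteq> x \<and> s (s x) = x" if "x \<in> A" for x
    using s[OF that] s[of "s x"] assms(4)[of "s x" "s (s x)" x] assms(5)[OF that] symD[OF assms(2)]
    by metis
  then show ?thesis using even_card_involution[OF assms(1)] by blast
qed

section \<open>Nodes, perimeter positions and matchings\<close>

lemma nodes_simps [simp]:
  "Lf i \<in> nodes n \<longleftrightarrow> 1 \<le> i \<and> i \<le> n" "Rt i \<in> nodes n \<longleftrightarrow> 1 \<le> i \<and> i \<le> n"
  by (auto simp: nodes_def)

lemma finite_nodes [simp]: "finite (nodes n)"
  by (simp add: nodes_def)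

lemma pos_bounds:
  assumes "p \<in> nodes n"
  shows "0 < pos n p" "pos n p \<le> 2 * n + 1" "pos n p \<noteq> n + 1"
  using assms by (cases p; auto)+

lemma pos_inject: "p \<in> nodes n \<Longrightarrow> q \<in> nodes n \<Longrightarrow> pos n p = pos n q \<longleftrightarrow> p = q"
  by (cases p; cases q) auto

definition boundary :: "'x target \<Rightarrow> bool" where
  "boundary t \<longleftrightarrow> (\<forall>q. t \<noteq> ToNode q)"

lemma boundary_simps [simp]:
  "boundary (ToTop a)" "boundary (ToBottom b)" "\<not> boundary (ToNode q)"
  by (auto simp: boundary_def)

lemma target_pos_boundary: "boundary t \<Longrightarrow> target_pos n t = 0 \<or> target_pos n t = n + 1"
  by (cases t) auto

text \<open>All of \<open>diagrams\<close> except planarity. That concatenation is well defined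
  rests on this part alone, so it is at hand before products are known to be planar.\<close>

definition matching :: "nat \<Rightarrow> 'x diagram \<Rightarrow> bool" where
  "matching n D \<longleftrightarrow> dom D = nodes n \<and>
     (\<forall>p q. D p = Some (ToNode q) \<longrightarrow> q \<noteq> p \<and> D q = Some (ToNode p))"

lemma diagrams_iff: "D \<in> diagrams n \<longleftrightarrow> matching n D \<and> noncrossing n D"
  by (auto simp: diagrams_def matching_def)

lemma matchingD:
  assumes "matching n D"
  shows "D p = Some (ToNode q) \<Longrightarrow> D q = Some (ToNode p)"
    and "D p = Some (ToNode q) \<Longrightarrow> q \<noteq> p"
    and "D p = Some t \<Longrightarrow> p \<in> nodes n"
    and "D p = Some (ToNode q) \<Longrightarrow> q \<in> nodes n"
    and "p \<in> nodes n \<Longrightarrow> \<exists>t. D p = Some t"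
    and "p \<notin> nodes n \<Longrightarrow> D p = None"
  using assms unfolding matching_def by blast+

lemma noncrossingD:
  assumes "noncrossing n D" "(a, c) \<in> chords n D \<union> (chords n D)\<inverse>"
    "(b, d) \<in> chords n D \<union> (chords n D)\<inverse>" "a < b" "b < c" "c < d"
  shows False
  using assms unfolding noncrossing_def Let_def by blast

text \<open>Unordered pairs of ends let each string be entered from either side, as its orientation
  along the perimeter varies between uses.\<close>

lemma noncrossing_strings:
  assumes "noncrossing n D" "D p = Some s" "D q = Some t"
    "{a, c} = {pos n p, target_pos n s}" "{b, d} = {pos n q, target_pos n t}"
    "a < b" "b < c" "c < d"
  shows False
proof (rule noncrossingD[OF assms(1) _ _ assms(6-8)])
  have "(pos n p, target_pos n s) \<in> chords n D" "(pos n q, target_pos n t) \<in> chords n D"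
    using assms(2,3) by (auto simp: chords_def)
  then show "(a, c) \<in> chords n D \<union> (chords n D)\<inverse>" "(b, d) \<in> chords n D \<union> (chords n D)\<inverse>"
    using assms(4,5) by (auto simp: doubleton_eq_iff)
qed

section \<open>Separation by a string inside one diagram\<close>

text \<open>As a set, it counts several endpoints on one boundary once. It is applied to the pieces
  of a single string, of which at most one reaches a boundary.\<close>

definition ends_of :: "nat \<Rightarrow> 'x diagram \<Rightarrow> node set \<Rightarrow> nat set" where
  "ends_of n D K = pos n ` K \<union> {target_pos n t | q t. q \<in> K \<and> D q = Some t}"

lemma ends_of_finite: "K \<subseteq> nodes n \<Longrightarrow> finite (ends_of n D K)"
proof -
  assume K: "K \<subseteq> nodes n"
  then have f: "finite K" using finite_subset finite_nodes by blast
  have "{target_pos n t | q t. q \<in> K \<and> D q = Some t} \<subseteq> (\<lambda>q. target_pos n (the (D q))) ` K"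
    by force
  then show ?thesis unfolding ends_of_def using f finite_subset by blast
qed

lemma ends_of_pos:
  assumes "matching n D" "K \<subseteq> nodes n" "p \<in> nodes n"
    and "\<And>q r. q \<in> K \<Longrightarrow> D q = Some (ToNode r) \<Longrightarrow> r \<in> K"
  shows "pos n p \<in> ends_of n D K \<longleftrightarrow> p \<in> K"
proof
  assume "pos n p \<in> ends_of n D K"
  then consider q where "q \<in> K" "pos n p = pos n q"
    | q t where "q \<in> K" "D q = Some t" "pos n p = target_pos n t"
    unfolding ends_of_def by blast
  then show "p \<in> K"
  proof cases
    case 1
    then show ?thesis using assms(2,3) pos_inject by blast
  next
    case 2
    then obtain r where t: "t = ToNode r"
      using pos_bounds[OF assms(3)] target_pos_boundary[of t n] unfolding boundary_def by fastforce
    then have "r \<in> K" using 2 assms(4) by blast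
    then show ?thesis using 2 t assms(2,3) pos_inject[of p n r] by auto
  qed
qed (auto simp: ends_of_def)

lemma ends_of_boundary:
  assumes "K \<subseteq> nodes n" "x = 0 \<or> x = n + 1"
  shows "x \<in> ends_of n D K \<longleftrightarrow> (\<exists>q\<in>K. \<exists>t. D q = Some t \<and> target_pos n t = x)"
proof -
  have "x \<notin> pos n ` K"
    using assms pos_bounds by (metis imageE in_mono less_not_refl)
  then show ?thesis unfolding ends_of_def by blast
qed

lemma target_pos_node:
  assumes "matching n D" "D q = Some t" "target_pos n t = pos n p" "p \<in> nodes n"
  shows "t = ToNode p"
proof (cases t)
  case (ToNode r)
  then show ?thesis using assms matchingD(4)[OF assms(1)] pos_inject by auto
qed (use assms pos_bounds[OF assms(4)] in auto)

text \<open>The chords at \<open>K\<close> pair up the ends, so their number is even. By planarity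
  no such chord leaves the perimeter segment between the two ends of a string outside
  \<open>K\<close>, so the ends in that segment are paired among themselves. The assumption
  \<open>uniq\<close> keeps the pairing functional at the shared boundary positions.\<close>

lemma separation:
  assumes D: "matching n D" and nc: "noncrossing n D" and K: "K \<subseteq> nodes n"
    and closed: "\<And>q r. q \<in> K \<Longrightarrow> D q = Some (ToNode r) \<Longrightarrow> r \<in> K"
    and uniq: "\<And>q r s t. q \<in> K \<Longrightarrow> r \<in> K \<Longrightarrow> D q = Some s \<Longrightarrow> D r = Some t \<Longrightarrow>
        boundary s \<Longrightarrow> boundary t \<Longrightarrow> q = r"
  shows "even (card (ends_of n D K))"
    and "q \<notin> K \<Longrightarrow> D q = Some t \<Longrightarrow> target_pos n t \<notin> ends_of n D K \<Longrightarrow>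
      even (card {y \<in> ends_of n D K. y < pos n q}) \<longleftrightarrow>
      even (card {y \<in> ends_of n D K. y < target_pos n t})"
proof -
  let ?A = "ends_of n D K"
  define R where "R = {(pos n q, target_pos n t) | q t. q \<in> K \<and> D q = Some t}"
  define S where "S = R \<union> R\<inverse>"
  have Sch: "S \<subseteq> chords n D \<union> (chords n D)\<inverse>"
    unfolding S_def R_def chords_def by blast
  have symS: "sym S" unfolding S_def by (rule sym_Un_converse)
  have fin: "finite ?A" using ends_of_finite K by blast
  have total: "\<exists>y\<in>?A. (x, y) \<in> S" if x: "x \<in> ?A" for x
  proof -
    consider q where "q \<in> K" "x = pos n q" | q t where "q \<in> K" "D q = Some t" "x = target_pos n t"
      using x unfolding ends_of_def by blast
    then show ?thesis
    proof cases
      case 1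
      then obtain t where "D q = Some t" using K matchingD(5)[OF D, of q] by auto
      then show ?thesis using 1 unfolding ends_of_def S_def R_def by blast
    next
      case 2
      then show ?thesis unfolding ends_of_def S_def R_def by blast
    qed
  qed
  \<comment> \<open>At the position of a node the partner is forced: a chord met at its far end is
    the same string read backwards.\<close>
  have S_pos: "D p = Some t \<and> y = target_pos n t" if S: "(pos n p, y) \<in> S" "p \<in> K" "D p = Some t" for p y t
  proof -
    have p: "p \<in> nodes n" using S K by blast
    consider q s where "q \<in> K" "D q = Some s" "pos n p = pos n q" "y = target_pos n s"
      | q s where "q \<in> K" "D q = Some s" "pos n p = target_pos n s" "y = pos n q"
      using S unfolding S_def R_def by blast
    then show ?thesis
    proof cases
      case 1
      then have "p = q" using p K pos_inject[of p n q] by auto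
      then show ?thesis using 1 S by simp
    next
      case 2
      then have "s = ToNode p" using target_pos_node[OF D 2(2)] p by simp
      then have "D p = Some (ToNode q)" using 2 matchingD(1)[OF D, of q p] by simp
      then show ?thesis using 2 S by simp
    qed
  qed
  have functional: "y = z" if "(x, y) \<in> S" "(x, z) \<in> S" for x y z
  proof (cases "x \<in> pos n ` K")
    case True
    then obtain p where p: "p \<in> K" "x = pos n p" by blast
    then obtain t where "D p = Some t" using K matchingD(5)[OF D, of p] by auto
    then show ?thesis using S_pos that p by metis
  next
    case False
    \<comment> \<open>Away from the nodes of \<open>K\<close>, the position can only be the boundary
      end of a string, and \<open>uniq\<close> admits one such string.\<close>
    have *: "\<exists>q s. q \<in> K \<and> D q = Some s \<and> x = target_pos n s \<and> y = pos n q \<and> boundary s"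
      if xy: "(x, y) \<in> S" for y
    proof -
      obtain q s where q: "q \<in> K" "D q = Some s" "x = target_pos n s" "y = pos n q"
        using xy False unfolding S_def R_def by blast
      have "boundary s" unfolding boundary_def
        using q closed False by auto
      then show ?thesis using q by blast
    qed
    show ?thesis using *[OF that(1)] *[OF that(2)] uniq by metis
  qed
  have irrefl: "(x, x) \<notin> S" for x
  proof
    assume "(x, x) \<in> S"
    then obtain q s where q: "q \<in> K" "D q = Some s" "pos n q = target_pos n s"
      unfolding S_def R_def by auto
    then have "s = ToNode q" using target_pos_node[OF D q(2)] K by auto
    then show False using q matchingD(2)[OF D, of q q] by blast
  qed
  show "even (card ?A)"
    using even_card_matching[OF fin symS] total functional irrefl by blast
  assume q: "q \<notin> K" "D q = Some t" "target_pos n t \<notin> ?A"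
  have qn: "q \<in> nodes n" using matchingD(3)[OF D q(2)] .
  have pq: "pos n q \<notin> ?A" using ends_of_pos[OF D K qn] closed q by blast
  have chord: "(pos n q, target_pos n t) \<in> chords n D"
    using q unfolding chords_def by blast
  have key: "even (card {y \<in> ?A. y < c}) \<longleftrightarrow> even (card {y \<in> ?A. y < d})"
    if cd: "c < d" "c \<notin> ?A" "d \<notin> ?A" "(c, d) \<in> chords n D \<union> (chords n D)\<inverse>" for c d
  proof -
    let ?M = "{y \<in> ?A. c < y \<and> y < d}"
    have "even (card ?M)"
    proof (rule even_card_matching[OF _ symS])
      show "finite ?M" using fin by simp
      show "\<exists>y\<in>?M. (x, y) \<in> S" if x: "x \<in> ?M" for x
      proof -
        obtain y where y: "y \<in> ?A" "(x, y) \<in> S" using total x by blast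
        have yx: "(y, x) \<in> S" using symS y by (meson symD)
        have "\<not> y < c"
          using noncrossingD[OF nc, of y x c d] yx Sch cd x by blast
        moreover have "\<not> d < y"
          using noncrossingD[OF nc, of c d x y] y Sch cd x by blast
        moreover have "y \<noteq> c" "y \<noteq> d" using y cd by auto
        ultimately show ?thesis using y by auto
      qed
    qed (use functional irrefl in blast)+
    moreover have "y < d \<longleftrightarrow> y < c \<or> c < y \<and> y < d" if "y \<in> ?A" for y
      using cd(1,2) that by (metis less_trans linorder_neqE_nat)
    then have "{y \<in> ?A. y < d} = {y \<in> ?A. y < c} \<union> ?M" by blast
    then have "card {y \<in> ?A. y < d} = card {y \<in> ?A. y < c} + card ?M"
      using fin by (simp add: card_Un_disjoint disjoint_iff)
    ultimately show ?thesis by simp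
  qed
  show "even (card {y \<in> ?A. y < pos n q}) \<longleftrightarrow> even (card {y \<in> ?A. y < target_pos n t})"
  proof (cases "pos n q" "target_pos n t" rule: linorder_cases)
    case less
    then show ?thesis using key pq q chord by blast
  next
    case greater
    then show ?thesis using key[of "target_pos n t" "pos n q"] pq q chord by blast
  qed simp
qed

section \<open>Following a string through a concatenation\<close>

fun same_side :: "vertex \<Rightarrow> node \<Rightarrow> vertex" where
  "same_side (Inl p) q = Inl q"
| "same_side (Inr p) q = Inr q"

text \<open>Starting at \<open>v\<close>, the string is followed first inside the factor containing \<open>v\<close> (flag
  \<open>True\<close>) or first across the middle line (flag \<open>False\<close>); \<open>u\<close> is the last vertex met.\<close>

inductive trace :: "nat \<Rightarrow> 'x diagram \<Rightarrow> 'x diagram \<Rightarrow> bool \<Rightarrow> vertex \<Rightarrow> vertex \<Rightarrow> 'x target \<Rightarrow> bool"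
  for n D E where
  stop: "target_at D E v = Some t \<Longrightarrow> boundary t \<Longrightarrow> trace n D E True v v t"
| inside: "target_at D E v = Some (ToNode q) \<Longrightarrow> trace n D E False (same_side v q) u t \<Longrightarrow>
    trace n D E True v u t"
| exit: "p \<in> nodes n \<Longrightarrow> trace n D E False (outer p) (outer p) (ToNode p)"
| rightwards: "i \<in> {1..n} \<Longrightarrow> trace n D E True (Inr (Lf i)) u t \<Longrightarrow> trace n D E False (Inl (Rt i)) u t"
| leftwards: "i \<in> {1..n} \<Longrightarrow> trace n D E True (Inl (Rt i)) u t \<Longrightarrow> trace n D E False (Inr (Lf i)) u t"

lemma outer_neq [simp]:
  "outer p \<noteq> Inl (Rt i)" "outer p \<noteq> Inr (Lf i)" "Inl (Rt i) \<noteq> outer p" "Inr (Lf i) \<noteq> outer p"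
  by (cases p; simp)+

lemma outer_inject [simp]: "outer p = outer q \<longleftrightarrow> p = q"
  by (cases p; cases q; simp)

inductive_cases trace_TrueE: "trace n D E True v u t"
inductive_cases trace_outerE: "trace n D E False (outer p) u t"
inductive_cases trace_RtE: "trace n D E False (Inl (Rt i)) u t"
inductive_cases trace_LfE: "trace n D E False (Inr (Lf i)) u t"

text \<open>For a given flag and vertex at most one rule applies: boundary targets, node targets,
  outer vertices and inner vertices exclude one another. This is the uniqueness behind the
  \<open>THE\<close> in \<open>concat_diagram\<close>.\<close>

lemma trace_deterministic:
  "trace n D E b v u t \<Longrightarrow> trace n D E b v u' t' \<Longrightarrow> u' = u \<and> t' = t"
proof (induction arbitrary: u' t' rule: trace.induct)
  case (stop v t)
  from stop(3) show ?case by (rule trace_TrueE) (use stop(1,2) in simp_all)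
next
  case (inside v q u t)
  from inside(4) show ?case by (rule trace_TrueE) (use inside(1,3) in \<open>auto simp: boundary_def\<close>)
next
  case (exit p)
  from exit(2) show ?case by (rule trace_outerE) simp_all
next
  case (rightwards i u t)
  from rightwards(4) show ?case by (rule trace_RtE) (use rightwards(3) in auto)
next
  case (leftwards i u t)
  from leftwards(4) show ?case by (rule trace_LfE) (use leftwards(3) in auto)
qed

section \<open>Connectivity and traces in a product of two matchings\<close>

locale composable =
  fixes n :: nat and D E :: "'x diagram"
  assumes D: "matching n D" and E: "matching n E"
begin

abbreviation steps :: "vertex rel" where
  "steps \<equiv> joins n D E \<union> (joins n D E)\<inverse>"

definition vertices :: "vertex set" where
  "vertices = Inl ` nodes n \<union> Inr ` nodes n"

lemma target_at_node:
  assumes "target_at D E v = Some (ToNode q)"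
  shows "target_at D E (same_side v q) = Some (ToNode (case v of Inl p \<Rightarrow> p | Inr p \<Rightarrow> p))"
    "(v, same_side v q) \<in> joins n D E" "same_side v q \<noteq> v"
proof -
  consider p where "v = Inl p" "D p = Some (ToNode q)" | p where "v = Inr p" "E p = Some (ToNode q)"
    using assms by (cases v) auto
  then have "target_at D E (same_side v q) = Some (ToNode (case v of Inl p \<Rightarrow> p | Inr p \<Rightarrow> p)) \<and>
      (v, same_side v q) \<in> joins n D E \<and> same_side v q \<noteq> v"
  proof cases
    case (1 p)
    then show ?thesis using matchingD(1,2)[OF D 1(2)] by (auto simp: joins_def)
  next
    case (2 p)
    then show ?thesis using matchingD(1,2)[OF E 2(2)] by (auto simp: joins_def)
  qed
  then show "target_at D E (same_side v q) = Some (ToNode (case v of Inl p \<Rightarrow> p | Inr p \<Rightarrow> p))"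
    "(v, same_side v q) \<in> joins n D E" "same_side v q \<noteq> v" by blast+
qed

lemma steps_cases:
  assumes "(v, w) \<in> steps"
  obtains (inside) q where "target_at D E v = Some (ToNode q)" "w = same_side v q"
    "\<exists>p. target_at D E w = Some (ToNode p) \<and> v = same_side w p"
  | (rightwards) i where "i \<in> {1..n}" "v = Inl (Rt i)" "w = Inr (Lf i)"
  | (leftwards) i where "i \<in> {1..n}" "v = Inr (Lf i)" "w = Inl (Rt i)"
proof -
  consider p q where "D p = Some (ToNode q)" "v = Inl p" "w = Inl q"
    | p q where "E p = Some (ToNode q)" "v = Inr p" "w = Inr q"
    | i where "i \<in> {1..n}" "v = Inl (Rt i)" "w = Inr (Lf i)"
    | i where "i \<in> {1..n}" "v = Inr (Lf i)" "w = Inl (Rt i)"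
    using assms matchingD(1)[OF D] matchingD(1)[OF E] unfolding joins_def by blast
  then show thesis
  proof cases
    case (1 p q)
    then show ?thesis using inside[of q] matchingD(1)[OF D 1(1)] by simp
  next
    case (2 p q)
    then show ?thesis using inside[of q] matchingD(1)[OF E 2(1)] by simp
  qed (use rightwards leftwards in blast)+
qed

lemma connected_sym: "(v, w) \<in> connected_in n D E \<Longrightarrow> (w, v) \<in> connected_in n D E"
  unfolding connected_in_def by (meson sym_Un_converse sym_rtrancl symD)

lemma connected_step: "(u, v) \<in> connected_in n D E \<Longrightarrow> (v, w) \<in> steps \<Longrightarrow> (u, w) \<in> connected_in n D E"
  unfolding connected_in_def by (rule rtrancl_into_rtrancl)

lemma connected_refl [simp]: "(u, u) \<in> connected_in n D E"
  unfolding connected_in_def by simp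

lemma connected_vertices:
  assumes "(u, v) \<in> connected_in n D E" "u \<in> vertices"
  shows "v \<in> vertices"
  using assms unfolding connected_in_def
proof (induction rule: rtrancl_induct)
  case (step v w)
  from step(2) show ?case
  proof (cases rule: steps_cases)
    case (inside q)
    then show ?thesis
      by (cases v) (auto simp: vertices_def dest: matchingD(4)[OF D] matchingD(4)[OF E])
  qed (auto simp: vertices_def)
qed

lemma outer_vertices: "outer p \<in> vertices \<longleftrightarrow> p \<in> nodes n"
  by (cases p) (auto simp: vertices_def)

text \<open>A step along the string either is the first move of the trace, and is dropped, or its
  reverse can be put in front. Thus undirected connectivity is turned into following a string in one
  direction.\<close>

lemma trace_connected:
  assumes "(v, w) \<in> connected_in n D E" "trace n D E True v u t \<or> trace n D E False v u t"
  shows "trace n D E True w u t \<or> trace n D E False w u t"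
  using assms unfolding connected_in_def
proof (induction rule: rtrancl_induct)
  case (step v w)
  then have IH: "trace n D E True v u t \<or> trace n D E False v u t" by blast
  from step(2) show ?case
  proof (cases rule: steps_cases)
    case (inside q)
    show ?thesis
      using IH inside trace.inside[of D E w]
      by (metis trace_TrueE boundary_simps(3) option.inject target.inject(1))
  next
    case (rightwards i)
    then show ?thesis using IH trace.leftwards[of i n D E u t] by (metis trace_RtE)
  next
    case (leftwards i)
    then show ?thesis using IH trace.rightwards[of i n D E u t] by (metis trace_LfE)
  qed
qed

text \<open>At its far end the trace is trivial, and it is transported back along the component. At
  \<open>outer p\<close> the flag \<open>False\<close> would mean leaving at once through
  \<open>p\<close>, so the flag is \<open>True\<close>.\<close>

lemma trace_boundary:
  assumes "(outer p, v) \<in> connected_in n D E" "target_at D E v = Some t" "boundary t"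
  shows "trace n D E True (outer p) v t"
proof -
  have "trace n D E True (outer p) v t \<or> trace n D E False (outer p) v t"
    using trace_connected[OF connected_sym[OF assms(1)]] trace.stop[OF assms(2,3)] by blast
  then show ?thesis using assms(3) boundary_simps(3) trace_outerE by metis
qed

lemma trace_outer:
  assumes "(outer p, outer q) \<in> connected_in n D E" "q \<noteq> p" "q \<in> nodes n"
  shows "trace n D E True (outer p) (outer q) (ToNode q)"
proof -
  have "trace n D E True (outer p) (outer q) (ToNode q) \<or> trace n D E False (outer p) (outer q) (ToNode q)"
    using trace_connected[OF connected_sym[OF assms(1)]] trace.exit[OF assms(3)] by blast
  then show ?thesis using assms(2) by (metis trace_outerE outer_inject)
qed

lemma leads_to_trace:
  assumes "p \<in> nodes n" "leads_to n D E p t"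
  shows "\<exists>u. trace n D E True (outer p) u t"
proof (cases t)
  case (ToNode q)
  then have "q \<in> nodes n"
    using assms connected_vertices[of "outer p" "outer q"] by (simp add: outer_vertices)
  then show ?thesis using ToNode assms trace_outer by auto
qed (use assms trace_boundary in fastforce)+

text \<open>If the component of an outer node had no second end, its number of vertices would be even
  (match along strings) and odd (match all but the outer node across the middle line).\<close>

lemma leads_to_exists:
  assumes p: "p \<in> nodes n"
  shows "\<exists>t. leads_to n D E p t"
proof (rule ccontr)
  assume no: "\<nexists>t. leads_to n D E p t"
  define C where "C = {v. (outer p, v) \<in> connected_in n D E}"
  have Cv: "C \<subseteq> vertices"
    unfolding C_def using connected_vertices p by (auto simp: outer_vertices)
  have fin: "finite C"
    using Cv finite_subset[of C vertices] by (simp add: vertices_def)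
  have str: "\<exists>q. target_at D E v = Some (ToNode q)" if v: "v \<in> C" for v
  proof -
    obtain t where t: "target_at D E v = Some t"
      using subsetD[OF Cv v] matchingD(5)[OF D] matchingD(5)[OF E]
      by (cases v) (auto simp: vertices_def)
    then show ?thesis
      using no v leads_to.simps(2,3)[of n D E p] unfolding C_def by (cases t) blast+
  qed
  define s where "s v = (case target_at D E v of Some (ToNode q) \<Rightarrow> same_side v q | _ \<Rightarrow> v)" for v
  have "even (card C)"
  proof (rule even_card_involution[OF fin, of s])
    fix v assume v: "v \<in> C"
    then obtain q where q: "target_at D E v = Some (ToNode q)" using str by blast
    have "same_side v q \<in> C"
      using v connected_step target_at_node(2)[OF q] unfolding C_def by blast
    then show "s v \<in> C \<and> s v \<noteq> v \<and> s (s v) = v"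
      using q target_at_node[OF q] by (cases v) (auto simp: s_def)
  qed
  moreover have "even (card (C - {outer p}))"
  proof (rule even_card_involution)
    show "finite (C - {outer p})" using fin by simp
    define m where "m v = (case v of Inl (Rt i) \<Rightarrow> Inr (Lf i) | Inr (Lf i) \<Rightarrow> Inl (Rt i) | _ \<Rightarrow> v)"
      for v :: vertex
    fix v assume v: "v \<in> C - {outer p}"
    have "v \<noteq> outer q" for q
    proof
      assume "v = outer q"
      then have "leads_to n D E p (ToNode q)" using v by (auto simp: C_def)
      then show False using no by blast
    qed
    moreover have "(\<exists>i\<in>{1..n}. v = Inl (Rt i) \<or> v = Inr (Lf i)) \<or> (\<exists>q. v = outer q)"
    proof -
      have "v \<in> vertices" using v Cv by blast
      then consider i where "i \<in> {1..n}" "v = Inl (Lf i)" | i where "i \<in> {1..n}" "v = Inl (Rt i)"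
        | i where "i \<in> {1..n}" "v = Inr (Lf i)" | i where "i \<in> {1..n}" "v = Inr (Rt i)"
        by (auto simp: vertices_def nodes_def)
      then show ?thesis
        by cases (use outer.simps in metis)+
    qed
    ultimately have "\<exists>i\<in>{1..n}. v = Inl (Rt i) \<or> v = Inr (Lf i)" by blast
    then obtain i where i: "i \<in> {1..n}" "v = Inl (Rt i) \<or> v = Inr (Lf i)" by blast
    then have "(v, m v) \<in> steps" "m v \<noteq> v" "m (m v) = v" "m v \<noteq> outer p"
      by (auto simp: m_def joins_def)
    then show "m v \<in> C - {outer p} \<and> m v \<noteq> v \<and> m (m v) = v"
      using v connected_step unfolding C_def by blast
  qed
  moreover have "outer p \<in> C" by (simp add: C_def)
  then have "card C = Suc (card (C - {outer p}))" using card.remove fin by metis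
  ultimately show False by simp
qed

lemma concat_leads_to:
  assumes "p \<in> nodes n"
  shows "\<exists>t. concat_diagram n D E p = Some t \<and> leads_to n D E p t"
proof -
  obtain t where t: "leads_to n D E p t" using leads_to_exists assms by blast
  have "(THE t. leads_to n D E p t) = t"
    using t leads_to_trace[OF assms] trace_deterministic by (metis the_equality)
  then show ?thesis using t assms by (simp add: concat_diagram_def)
qed

lemma concat_eqI:
  assumes "p \<in> nodes n" "trace n D E True (outer p) u t"
  shows "concat_diagram n D E p = Some t"
  using concat_leads_to[OF assms(1)] leads_to_trace[OF assms(1)] trace_deterministic assms(2)
  by metis

lemma concat_eqD:
  assumes "concat_diagram n D E p = Some t"
  shows "p \<in> nodes n" "leads_to n D E p t" "\<exists>u. trace n D E True (outer p) u t"
proof -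
  show p: "p \<in> nodes n" using assms by (auto simp: concat_diagram_def split: if_splits)
  show "leads_to n D E p t" using concat_leads_to[OF p] assms by auto
  then show "\<exists>u. trace n D E True (outer p) u t" using leads_to_trace[OF p] by blast
qed

lemma matching_concat: "matching n (concat_diagram n D E)"
  unfolding matching_def
proof (intro conjI allI impI)
  show "dom (concat_diagram n D E) = nodes n"
    by (auto simp: concat_diagram_def dom_def)
  fix p q assume *: "concat_diagram n D E p = Some (ToNode q)"
  note p = concat_eqD[OF *]
  show qp: "q \<noteq> p" using p by simp
  have con: "(outer p, outer q) \<in> connected_in n D E" using p by simp
  then have q: "q \<in> nodes n" using p connected_vertices outer_vertices by blast
  show "concat_diagram n D E q = Some (ToNode p)"
    using concat_eqI[OF q trace_outer] connected_sym[OF con] p(1) qp by metis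
qed

end

section \<open>Concatenation preserves planarity\<close>

abbreviation below :: "nat set \<Rightarrow> nat \<Rightarrow> nat" where
  "below X x \<equiv> card {y \<in> X. y < x}"

text \<open>Ends may be counted from either direction along the perimeter; positions on the right
  are compared from the far end.\<close>

lemma below_parity:
  assumes "finite X" "even (card X)" "x \<notin> X"
  shows "even (below X x) \<longleftrightarrow> even (card {y \<in> X. x < y})"
proof -
  have X: "y < x \<or> x < y" if "y \<in> X" for y using that assms(3) by (cases "y = x") auto
  have "card X = card ({y \<in> X. y < x} \<union> {y \<in> X. x < y})"
    by (rule arg_cong[where f = card]) (use X in blast)
  also have "\<dots> = below X x + card {y \<in> X. x < y}"
    by (rule card_Un_disjoint) (use assms(1) in auto)
  finally show ?thesis using assms(2) by presburger
qed

text \<open>Here \<open>A\<close> and \<open>B\<close> are the ends, in the two factors, of the pieces of one string of a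
  concatenation, and \<open>M\<close> are the ends of the string itself.\<close>

lemma glued_parity:
  fixes A B M :: "nat set"
  assumes fin: "finite A" "finite B" "finite M"
    and even: "even (card A)" "even (card B)" "even (card M)"
    and bound: "\<And>y. y \<in> A \<Longrightarrow> y \<le> 2 * n + 1"
    and left: "\<And>y. 1 \<le> y \<Longrightarrow> y \<le> n \<Longrightarrow> y \<in> A \<longleftrightarrow> y \<in> M"
    and right: "\<And>y. n + 1 < y \<Longrightarrow> y \<in> B \<longleftrightarrow> y \<in> M"
    and zero: "0 \<in> M \<longleftrightarrow> 0 \<in> A \<or> 0 \<in> B" "\<not> (0 \<in> A \<and> 0 \<in> B)"
    and middle: "\<And>i. 1 \<le> i \<Longrightarrow> i \<le> n \<Longrightarrow> 2 * n + 2 - i \<in> A \<longleftrightarrow> i \<in> B"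
  shows "1 \<le> i \<Longrightarrow> i \<le> n \<Longrightarrow> i \<notin> B \<Longrightarrow>
      even (below A (2 * n + 2 - i) + of_bool (0 \<in> B)) \<longleftrightarrow> even (below B i)"
    and "x \<le> n + 1 \<Longrightarrow> x \<notin> M \<Longrightarrow>
      even (below A x + of_bool (0 \<in> B)) \<longleftrightarrow> even (below M x)"
    and "n < x \<or> x = 0 \<Longrightarrow> x \<notin> M \<Longrightarrow> x \<notin> B \<Longrightarrow> even (below B x) \<longleftrightarrow> even (below M x)"
proof -
  show "even (below A (2 * n + 2 - i) + of_bool (0 \<in> B)) \<longleftrightarrow> even (below B i)"
    if i: "1 \<le> i" "i \<le> n" "i \<notin> B"
  proof -
    \<comment> \<open>Right node \<open>i\<close> of the left factor has position
      \<open>2 * n + 2 - i\<close> and is glued to a node at position \<open>i\<close>. The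
      reflection matches ends of \<open>A\<close> past the former with ends of \<open>B\<close>
      before the latter, except for the top at 0, which accounts for
      \<open>of_bool (0 \<in> B)\<close>.\<close>
    have "bij_betw (\<lambda>j. 2 * n + 2 - j) {j \<in> B. 0 < j \<and> j < i} {y \<in> A. 2 * n + 2 - i < y}"
    proof (rule bij_betw_byWitness[where f' = "\<lambda>j. 2 * n + 2 - j"])
      show "(\<lambda>j. 2 * n + 2 - j) ` {j \<in> B. 0 < j \<and> j < i} \<subseteq> {y \<in> A. 2 * n + 2 - i < y}"
        using i middle by auto
      show "(\<lambda>j. 2 * n + 2 - j) ` {y \<in> A. 2 * n + 2 - i < y} \<subseteq> {j \<in> B. 0 < j \<and> j < i}"
      proof clarify
        fix y assume y: "y \<in> A" "2 * n + 2 - i < y"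
        then have "y \<le> 2 * n + 1" using bound by blast
        then show "2 * n + 2 - y \<in> B \<and> 0 < 2 * n + 2 - y \<and> 2 * n + 2 - y < i"
          using y i middle[of "2 * n + 2 - y"] by auto
      qed
    qed (use i bound in \<open>force+\<close>)
    then have c: "card {j \<in> B. 0 < j \<and> j < i} = card {y \<in> A. 2 * n + 2 - i < y}"
      by (rule bij_betw_same_card)
    have "{y \<in> B. y < i} = {j \<in> B. 0 < j \<and> j < i} \<union> (if 0 \<in> B then {0} else {})"
      using i by (auto intro!: gr0I)
    then have "below B i = card {j \<in> B. 0 < j \<and> j < i} + of_bool (0 \<in> B)"
      using fin by (auto simp: card_Un_disjoint)
    then show ?thesis
      using c below_parity[OF fin(1) even(1), of "2 * n + 2 - i"] middle i by auto
  qed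
  show "even (below A x + of_bool (0 \<in> B)) \<longleftrightarrow> even (below M x)" if x: "x \<le> n + 1" "x \<notin> M"
  proof (cases "x = 0")
    case True
    then show ?thesis using x zero by auto
  next
    case False
    have "y \<in> M \<longleftrightarrow> y \<in> A \<or> y = 0 \<and> 0 \<in> B" if "y < x" for y
      using left[of y] zero x that by (cases "y = 0") auto
    then have "{y \<in> M. y < x} = {y \<in> A. y < x} \<union> (if 0 \<in> B then {0} else {})"
      using False by (intro set_eqI) auto
    moreover have "card ({y \<in> A. y < x} \<union> (if 0 \<in> B then {0} else {})) =
        below A x + of_bool (0 \<in> B)"
      using fin(1) zero(2) by (auto simp: card_Un_disjoint)
    ultimately have "below M x = below A x + of_bool (0 \<in> B)" by simp
    then show ?thesis by simp
  qed
  show "even (below B x) \<longleftrightarrow> even (below M x)" if x: "n < x \<or> x = 0" "x \<notin> M" "x \<notin> B"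
  proof (cases "x = 0")
    case False
    \<comment> \<open>\<open>B\<close> and \<open>M\<close> agree on the right side, that is, above
      \<open>x\<close>, so the ends are counted from above.\<close>
    then have "{y \<in> B. x < y} = {y \<in> M. x < y}" using right x by auto
    then show ?thesis using below_parity x fin even by metis
  qed simp
qed

context composable
begin

text \<open>The side of a string on which a vertex lies is the parity of the number of ends of that
  string below it along the perimeter.  It is constant along any other string, so the ends of two
  strings do not interleave.\<close>

lemma noncrossing_concat:
  assumes ncD: "noncrossing n D" and ncE: "noncrossing n E"
  shows "noncrossing n (concat_diagram n D E)"
proof (rule ccontr)
  let ?F = "concat_diagram n D E"
  assume "\<not> noncrossing n ?F"
  then obtain a b c d where ac: "(a, c) \<in> chords n ?F \<union> (chords n ?F)\<inverse>"
    and bd: "(b, d) \<in> chords n ?F \<union> (chords n ?F)\<inverse>" and abcd: "a < b" "b < c" "c < d"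
    unfolding noncrossing_def Let_def by blast
  have str: "\<exists>p t. ?F p = Some t \<and> {x, y} = {pos n p, target_pos n t}"
    if "(x, y) \<in> chords n ?F \<union> (chords n ?F)\<inverse>" for x y
    using that unfolding chords_def by blast
  obtain p t where p: "?F p = Some t" and ac': "{a, c} = {pos n p, target_pos n t}"
    using str[OF ac] by blast
  obtain q s where q: "?F q = Some s" and bd': "{b, d} = {pos n q, target_pos n s}"
    using str[OF bd] by blast
  note pn = concat_eqD(1)[OF p] and qn = concat_eqD(1)[OF q]
  obtain u where tr: "trace n D E True (outer p) u t" using concat_eqD(3)[OF p] by blast
  define M where "M = {a, c}"
  have M: "M = {pos n p, target_pos n t}" using ac' by (simp add: M_def)
  define C where "C = {v. (outer p, v) \<in> connected_in n D E}"
  have C_step: "w \<in> C \<longleftrightarrow> v \<in> C" if "(v, w) \<in> steps" for v w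
    using that connected_step[of "outer p"] unfolding C_def by blast
  have C_vertices: "v \<in> vertices" if "v \<in> C" for v
    using that connected_vertices outer_vertices pn unfolding C_def by blast
  have C_outer: "outer r \<in> C \<longleftrightarrow> pos n r \<in> M" if r: "r \<in> nodes n" for r
  proof
    assume "outer r \<in> C"
    then have "r = p \<or> t = ToNode r"
      using trace_outer[of p r] r trace_deterministic[OF tr] unfolding C_def by blast
    then show "pos n r \<in> M" using M by auto
  next
    assume "pos n r \<in> M"
    then have "pos n r = pos n p \<or> target_pos n t = pos n r" using M by auto
    then have "r = p \<or> t = ToNode r"
      using pos_inject[OF r pn] target_pos_node[OF matching_concat p _ r] by blast
    then show "outer r \<in> C" using concat_eqD(2)[OF p] by (auto simp: C_def)
  qed
  have C_boundary: "v = u \<and> t' = t" if "v \<in> C" "target_at D E v = Some t'" "boundary t'" for v t'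
    using that trace_boundary trace_deterministic[OF tr] unfolding C_def by blast
  define KD where "KD = {r. Inl r \<in> C}"
  define KE where "KE = {r. Inr r \<in> C}"
  define A where "A = ends_of n D KD"
  define B where "B = ends_of n E KE"
  have KD: "KD \<subseteq> nodes n" and KE: "KE \<subseteq> nodes n"
    using C_vertices by (auto simp: KD_def KE_def vertices_def)
  have closedD: "r \<in> KD" if "r' \<in> KD" "D r' = Some (ToNode r)" for r r'
    using that C_step[of "Inl r'" "Inl r"] by (auto simp: KD_def joins_def)
  have closedE: "r \<in> KE" if "r' \<in> KE" "E r' = Some (ToNode r)" for r r'
    using that C_step[of "Inr r'" "Inr r"] by (auto simp: KE_def joins_def)
  have uniqD: "r = r'" if "r \<in> KD" "r' \<in> KD" "D r = Some x" "D r' = Some y" "boundary x" "boundary y"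
    for r r' x y
    using that C_boundary[of "Inl r" x] C_boundary[of "Inl r'" y] by (auto simp: KD_def)
  have uniqE: "r = r'" if "r \<in> KE" "r' \<in> KE" "E r = Some x" "E r' = Some y" "boundary x" "boundary y"
    for r r' x y
    using that C_boundary[of "Inr r" x] C_boundary[of "Inr r'" y] by (auto simp: KE_def)
  have sepD: "even (card A)"
    "\<And>q t. q \<notin> KD \<Longrightarrow> D q = Some t \<Longrightarrow> target_pos n t \<notin> A \<Longrightarrow>
      even (below A (pos n q)) \<longleftrightarrow> even (below A (target_pos n t))"
    unfolding A_def by (rule separation[OF D ncD KD]; (assumption | erule (5) uniqD | erule (1) closedD)+)+
  have sepE: "even (card B)"
    "\<And>q t. q \<notin> KE \<Longrightarrow> E q = Some t \<Longrightarrow> target_pos n t \<notin> B \<Longrightarrow>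
      even (below B (pos n q)) \<longleftrightarrow> even (below B (target_pos n t))"
    unfolding B_def by (rule separation[OF E ncE KE]; (assumption | erule (5) uniqE | erule (1) closedE)+)+
  have A_pos: "pos n r \<in> A \<longleftrightarrow> Inl r \<in> C" if "r \<in> nodes n" for r
    using ends_of_pos[OF D KD that] closedD by (simp add: A_def KD_def)
  have B_pos: "pos n r \<in> B \<longleftrightarrow> Inr r \<in> C" if "r \<in> nodes n" for r
    using ends_of_pos[OF E KE that] closedE by (simp add: B_def KE_def)
  have M_boundary: "x \<in> M \<longleftrightarrow> x = target_pos n t" if x: "x = 0 \<or> x = n + 1" for x
    using M pos_bounds[OF pn] x by (metis insert_iff less_irrefl singletonD)
  \<comment> \<open>A boundary end of the string belongs to whichever of its pieces reaches the
    boundary, in either factor.\<close>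
  have AB_boundary: "x \<in> A \<or> x \<in> B \<longleftrightarrow> x \<in> M" if x: "x = 0 \<or> x = n + 1" for x
  proof -
    have "x \<in> A \<or> x \<in> B \<longleftrightarrow> (\<exists>v\<in>C. \<exists>t'. target_at D E v = Some t' \<and> target_pos n t' = x)"
      (is "_ \<longleftrightarrow> ?R")
    proof -
      have "?R \<longleftrightarrow> (\<exists>r\<in>KD. \<exists>t'. D r = Some t' \<and> target_pos n t' = x) \<or>
          (\<exists>r\<in>KE. \<exists>t'. E r = Some t' \<and> target_pos n t' = x)" (is "_ \<longleftrightarrow> ?S")
      proof
        assume ?R
        then obtain v t' where v: "v \<in> C" "target_at D E v = Some t'" "target_pos n t' = x" by blast
        then show ?S by (cases v) (auto simp: KD_def KE_def)
      next
        assume ?S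
        then show ?R unfolding KD_def KE_def by (metis mem_Collect_eq target_at.simps)
      qed
      then show ?thesis
        using ends_of_boundary[OF KD x, of D] ends_of_boundary[OF KE x, of E] by (simp add: A_def B_def)
    qed
    also have "?R \<longleftrightarrow> x = target_pos n t"
    proof
      assume ?R
      then obtain v t' where v: "v \<in> C" "target_at D E v = Some t'" "target_pos n t' = x" by blast
      have "boundary t'"
        unfolding boundary_def
      proof (intro allI notI)
        fix r assume "t' = ToNode r"
        then have "r \<in> nodes n" using v matchingD(4)[OF D] matchingD(4)[OF E] by (cases v) auto
        then show False using pos_bounds[of r n] x v \<open>t' = ToNode r\<close> by auto
      qed
      then show "x = target_pos n t" using C_boundary v by blast
    next
      assume xt: "x = target_pos n t"
      have "\<exists>v. (outer p, v) \<in> connected_in n D E \<and> target_at D E v = Some t"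
      proof (cases t)
        case (ToNode r)
        then have "r \<in> nodes n" using matchingD(4)[OF matching_concat] p by blast
        then show ?thesis using pos_bounds[of r n] x xt ToNode by auto
      qed (use concat_eqD(2)[OF p] in auto)
      then show ?R using xt by (auto simp: C_def)
    qed
    finally show ?thesis using M_boundary[OF x] by simp
  qed
  \<comment> \<open>The string starts at the outer node \<open>p\<close> and has just one further
    end, so it cannot reach the top in both factors.\<close>
  have not_both: "\<not> (0 \<in> A \<and> 0 \<in> B)"
  proof
    assume "0 \<in> A \<and> 0 \<in> B"
    then obtain r r' x y where r: "r \<in> KD" "D r = Some x" "target_pos n x = 0"
      "r' \<in> KE" "E r' = Some y" "target_pos n y = 0"
      using ends_of_boundary[OF KD, of 0 D] ends_of_boundary[OF KE, of 0 E] by (auto simp: A_def B_def)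
    have "boundary z" if "target_pos n z = 0" "F r = Some (z :: 'x target)" "matching n F" for z F r
      unfolding boundary_def using that matchingD(4)[OF that(3), of r] pos_bounds(1) by fastforce
    then have "boundary x" "boundary y" using r D E by blast+
    then show False using r C_boundary[of "Inl r" x] C_boundary[of "Inr r'" y] by (auto simp: KD_def KE_def)
  qed
  have bound: "pos n r \<le> 2 * n + 1" if "r \<in> nodes n" for r using pos_bounds that by blast
  have tbound: "target_pos n x \<le> 2 * n + 1" if "F r = Some x" "matching n F" for F :: "'x diagram" and r x
    using that matchingD(4)[OF that(2), of r] bound by (cases x) auto
  have boundA: "y \<le> 2 * n + 1" if "y \<in> A" for y
    using that bound KD tbound[OF _ D] by (auto simp: A_def ends_of_def)
  have boundB: "y \<le> 2 * n + 1" if "y \<in> B" for y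
    using that bound KE tbound[OF _ E] by (auto simp: B_def ends_of_def)
  have boundM: "y \<le> 2 * n + 1" if "y \<in> M" for y
    using that M bound[OF pn] tbound[OF p matching_concat] by auto
  have left: "y \<in> A \<longleftrightarrow> y \<in> M" if "1 \<le> y" "y \<le> n" for y
    using A_pos[of "Lf y"] C_outer[of "Lf y"] that by simp
  have right: "y \<in> B \<longleftrightarrow> y \<in> M" if y: "n + 1 < y" for y
  proof (cases "y \<le> 2 * n + 1")
    case True
    then have "Rt (2 * n + 2 - y) \<in> nodes n" "pos n (Rt (2 * n + 2 - y)) = y" using y by auto
    then show ?thesis using B_pos C_outer by (metis outer.simps(2))
  next
    case False
    then show ?thesis using boundB boundM by blast
  qed
  have middle: "2 * n + 2 - i \<in> A \<longleftrightarrow> i \<in> B" if "1 \<le> i" "i \<le> n" for i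
  proof -
    have "(Inl (Rt i), Inr (Lf i)) \<in> steps" using that by (simp add: joins_def)
    then show ?thesis using C_step A_pos[of "Rt i"] B_pos[of "Lf i"] that by auto
  qed
  have fin: "finite A" "finite B" "finite M"
    using ends_of_finite KD KE by (auto simp: A_def B_def M_def)
  have evenM: "even (card M)" using abcd by (simp add: M_def)
  have zero: "0 \<in> M \<longleftrightarrow> 0 \<in> A \<or> 0 \<in> B" using AB_boundary by blast
  have glue:
    "\<And>i. 1 \<le> i \<Longrightarrow> i \<le> n \<Longrightarrow> i \<notin> B \<Longrightarrow>
      even (below A (2 * n + 2 - i) + of_bool (0 \<in> B)) \<longleftrightarrow> even (below B i)"
    "\<And>x. x \<le> n + 1 \<Longrightarrow> x \<notin> M \<Longrightarrow>
      even (below A x + of_bool (0 \<in> B)) \<longleftrightarrow> even (below M x)"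
    "\<And>x. n < x \<or> x = 0 \<Longrightarrow> x \<notin> M \<Longrightarrow> x \<notin> B \<Longrightarrow>
      even (below B x) \<longleftrightarrow> even (below M x)"
    by (rule glued_parity[OF fin sepD(1) sepE(1) evenM];
        (assumption | rule boundA left right zero not_both middle)+)+
  \<comment> \<open>The correction makes the two formulas agree across the middle line: a top end in
    the right factor is counted in \<open>B\<close> but not in \<open>A\<close>.\<close>
  define side where "side v = (case v of
      Inl r \<Rightarrow> even (below A (pos n r) + of_bool (0 \<in> B)) | Inr r \<Rightarrow> even (below B (pos n r)))"
    for v :: vertex
  have side_inside: "side w = side v" if w: "v \<notin> C" "target_at D E v = Some (ToNode r)" "w = same_side v r"
    for v w r
  proof -
    have "w \<notin> C" using C_step[of v w] target_at_node(2) w by blast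
    then show ?thesis
      using w matchingD(4)[OF D, of _ r] matchingD(4)[OF E, of _ r] A_pos[of r] B_pos[of r]
        sepD(2)[of _ "ToNode r"] sepE(2)[of _ "ToNode r"]
      by (cases v) (auto simp: side_def KD_def KE_def)
  qed
  have side_step: "side w = side v" if "(v, w) \<in> steps" "v \<notin> C" for v w
    using that(1)
  proof (cases rule: steps_cases)
    case (inside r)
    then show ?thesis using side_inside that(2) by blast
  next
    case (rightwards i)
    then show ?thesis
      using glue(1)[of i] B_pos[of "Lf i"] C_step[OF that(1)] that(2) by (simp add: side_def)
  next
    case (leftwards i)
    then show ?thesis
      using glue(1)[of i] B_pos[of "Lf i"] that(2) by (simp add: side_def)
  qed
  have side_conn: "w \<notin> C \<and> side w = side v" if "(v, w) \<in> connected_in n D E" "v \<notin> C" for v w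
    using that unfolding connected_in_def
  proof (induction rule: rtrancl_induct)
    case (step w w')
    then show ?case using C_step side_step by blast
  qed simp
  \<comment> \<open>On outer nodes the side depends on the two ends \<open>M\<close> alone,
    independently of how the string winds through the factors.\<close>
  have side_outer: "side (outer r) \<longleftrightarrow> even (below M (pos n r))" if "r \<in> nodes n" "outer r \<notin> C" for r
  proof (cases r)
    case (Lf i)
    then show ?thesis using glue(2)[of i] that C_outer[of r] by (simp add: side_def)
  next
    case (Rt i)
    then have "n < pos n r" using that by auto
    then show ?thesis
      using Rt glue(3)[of "pos n r"] that C_outer[of r] B_pos[of r] by (simp add: side_def)
  qed
  have notM: "pos n q \<notin> M" "target_pos n s \<notin> M"
    using bd' abcd by (auto simp: M_def doubleton_eq_iff)
  then have qC: "outer q \<notin> C" using C_outer qn by blast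
  have "side (outer q) \<longleftrightarrow> even (below M (target_pos n s))"
  proof (cases "boundary s")
    case True
    then obtain v where v: "(outer q, v) \<in> connected_in n D E" "target_at D E v = Some s"
      using concat_eqD(2)[OF q] by (cases s) auto
    have x: "target_pos n s = 0 \<or> target_pos n s = n + 1" using target_pos_boundary True by blast
    then have AB: "target_pos n s \<notin> A" "target_pos n s \<notin> B" using AB_boundary notM by blast+
    note vC = side_conn[OF v(1) qC]
    have "side v \<longleftrightarrow> even (below M (target_pos n s))"
    proof (cases v)
      case (Inl r)
      then show ?thesis
        using glue(2)[OF _ notM(2)] sepD(2)[of r s] x conjunct1[OF vC] v(2) AB
        by (auto simp: side_def KD_def)
    next
      case (Inr r)
      then show ?thesis
        using glue(3)[OF _ notM(2)] sepE(2)[of r s] x conjunct1[OF vC] v(2) AB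
        by (auto simp: side_def KE_def)
    qed
    then show ?thesis using vC by blast
  next
    case False
    then obtain r where r: "s = ToNode r" by (auto simp: boundary_def)
    then have con: "(outer q, outer r) \<in> connected_in n D E" using concat_eqD(2)[OF q] by simp
    have rn: "r \<in> nodes n" using matchingD(4)[OF matching_concat, of q r] q r by simp
    show ?thesis using side_conn[OF con qC] side_outer[OF rn] r by simp
  qed
  then have "even (below M b) \<longleftrightarrow> even (below M d)"
    using side_outer[OF qn qC] bd' by (auto simp: doubleton_eq_iff)
  \<comment> \<open>\<open>b\<close> and \<open>d\<close> are the ends of one string and so lie on
    the same side, yet one element of \<open>M\<close> precedes \<open>b\<close> and two precede
    \<open>d\<close>.\<close>
  moreover have "{y \<in> M. y < b} = {a}" "{y \<in> M. y < d} = {a, c}" using abcd by (auto simp: M_def)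
  ultimately show False using abcd by simp
qed

end


section \<open>The generators are diagrams\<close>

text \<open>Chords with a common sum of end positions are nested, and a chord between cyclic
  neighbours separates nothing; the last two alternatives are the neighbours
  \<open>2 * n + 1\<close> and 0. Through strings that keep, raise or lower the node number by one
  when read from left to right have the sums \<open>2 * n + 2\<close>, \<open>2 * n + 1\<close> and
  \<open>2 * n + 3\<close>, which are the values of \<open>k\<close> for the generators.\<close>

lemma noncrossingI:
  assumes sum: "\<And>p t. D p = Some t \<Longrightarrow>
      pos n p + target_pos n t = k \<or> pos n p = Suc (target_pos n t) \<or> target_pos n t = Suc (pos n p) \<or>
      pos n p = 0 \<and> target_pos n t = 2 * n + 1 \<or> pos n p = 2 * n + 1 \<and> target_pos n t = 0"
    and bound: "\<And>p t. D p = Some t \<Longrightarrow> pos n p \<le> 2 * n + 1 \<and> target_pos n t \<le> 2 * n + 1"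
  shows "noncrossing n D"
proof -
  let ?R = "chords n D \<union> (chords n D)\<inverse>"
  have R: "x \<le> 2 * n + 1 \<and> y \<le> 2 * n + 1 \<and> (x + y = k \<or> x = Suc y \<or> y = Suc x \<or>
      x = 0 \<and> y = 2 * n + 1 \<or> x = 2 * n + 1 \<and> y = 0)" if xy: "(x, y) \<in> ?R" for x y
  proof -
    obtain p t where p: "D p = Some t" "x = pos n p \<and> y = target_pos n t \<or> y = pos n p \<and> x = target_pos n t"
      using xy unfolding chords_def by blast
    show ?thesis using sum[OF p(1)] bound[OF p(1)] p(2) by auto
  qed
  have False if "(a, c) \<in> ?R" "(b, d) \<in> ?R" "a < b" "b < c" "c < d" for a b c d
    using R[OF that(1)] R[OF that(2)] that(3-5) by linarith
  then show ?thesis unfolding noncrossing_def Let_def by blast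
qed

lemma id_diagram: "id_diag n \<in> diagrams n"
  unfolding diagrams_iff
proof
  show "matching n (id_diag n :: 'a diagram)"
    by (auto simp: matching_def id_diag_def dom_def split: node.splits if_splits)
  show "noncrossing n (id_diag n :: 'a diagram)"
    by (rule noncrossingI[of _ _ "2 * n + 2"])
      (auto simp: id_diag_def split: node.splits if_splits)
qed

lemma e_diag_apply:
  "e_diag n i (Lf j) = (if j = i then Some (ToNode (Lf (i + 1))) else
    if j = i + 1 then Some (ToNode (Lf i)) else if 1 \<le> j \<and> j \<le> n then Some (ToNode (Rt j)) else None)"
  "e_diag n i (Rt j) = (if j = i then Some (ToNode (Rt (i + 1))) else
    if j = i + 1 then Some (ToNode (Rt i)) else if 1 \<le> j \<and> j \<le> n then Some (ToNode (Lf j)) else None)"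
  by (simp_all add: e_diag_def id_diag_def)

lemma e_diagram:
  assumes "1 \<le> i" "i \<le> n - 1"
  shows "e_diag n i \<in> diagrams n"
  unfolding diagrams_iff
proof
  show "matching n (e_diag n i :: 'a diagram)"
    unfolding matching_def
  proof (intro conjI allI impI)
    show "dom (e_diag n i :: 'a diagram) = nodes n"
    proof (rule set_eqI)
      show "p \<in> dom (e_diag n i :: 'a diagram) \<longleftrightarrow> p \<in> nodes n" for p
        using assms by (cases p) (auto simp: e_diag_apply dom_def)
    qed
    fix p q assume "e_diag n i p = Some (ToNode q :: 'a target)"
    then show "q \<noteq> p" "e_diag n i q = Some (ToNode p :: 'a target)"
      by (cases p; auto simp: e_diag_apply split: if_splits)+
  qed
  show "noncrossing n (e_diag n i :: 'a diagram)"
  proof (rule noncrossingI[of _ _ "2 * n + 2"])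
    fix p and t :: "'a target" assume "e_diag n i p = Some t"
    then show "pos n p \<le> 2 * n + 1 \<and> target_pos n t \<le> 2 * n + 1"
      "pos n p + target_pos n t = 2 * n + 2 \<or> pos n p = Suc (target_pos n t) \<or>
        target_pos n t = Suc (pos n p) \<or> pos n p = 0 \<and> target_pos n t = 2 * n + 1 \<or>
        pos n p = 2 * n + 1 \<and> target_pos n t = 0"
      using assms by (cases p; auto simp: e_diag_apply split: if_splits)+
  qed
qed

lemma f_top_diagram:
  assumes "n \<ge> 1"
  shows "f_top_diag n a b \<in> diagrams n"
  unfolding diagrams_iff
proof
  show "matching n (f_top_diag n a b)"
    using assms by (auto simp: matching_def f_top_diag_def id_diag_def dom_def split: node.splits if_splits)
  show "noncrossing n (f_top_diag n a b)"
    by (rule noncrossingI[of _ _ "2 * n + 2"])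
      (use assms in \<open>auto simp: f_top_diag_def id_diag_def split: node.splits if_splits\<close>)
qed

lemma f_bottom_diagram:
  assumes "n \<ge> 1"
  shows "f_bottom_diag n a b \<in> diagrams n"
  unfolding diagrams_iff
proof
  show "matching n (f_bottom_diag n a b)"
    using assms by (auto simp: matching_def f_bottom_diag_def id_diag_def dom_def split: node.splits if_splits)
  show "noncrossing n (f_bottom_diag n a b)"
    by (rule noncrossingI[of _ _ "2 * n + 2"])
      (use assms in \<open>auto simp: f_bottom_diag_def id_diag_def split: node.splits if_splits\<close>)
qed

lemma w_diagram:
  assumes "n \<ge> 1"
  shows "w_diag n a b \<in> diagrams n"
  unfolding diagrams_iff
proof
  show "matching n (w_diag n a b)"
    unfolding matching_def
  proof (intro conjI allI impI)
    show "dom (w_diag n a b) = nodes n" by (simp add: w_diag_def dom_def)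
    fix p q assume "w_diag n a b p = Some (ToNode q)"
    then show "q \<noteq> p" "w_diag n a b q = Some (ToNode p)"
      by (cases p; auto simp: w_diag_def split: if_splits)+
  qed
  show "noncrossing n (w_diag n a b)"
    by (rule noncrossingI[of _ _ "2 * n + 3"])
      (use assms in \<open>auto simp: w_diag_def split: node.splits if_splits\<close>)
qed

lemma v_diagram:
  assumes "n \<ge> 1"
  shows "v_diag n a b \<in> diagrams n"
  unfolding diagrams_iff
proof
  show "matching n (v_diag n a b)"
    unfolding matching_def
  proof (intro conjI allI impI)
    show "dom (v_diag n a b) = nodes n" by (simp add: v_diag_def dom_def)
    fix p q assume "v_diag n a b p = Some (ToNode q)"
    then show "q \<noteq> p" "v_diag n a b q = Some (ToNode p)"
      by (cases p; auto simp: v_diag_def split: if_splits)+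
  qed
  show "noncrossing n (v_diag n a b)"
    by (rule noncrossingI[of _ _ "2 * n + 1"])
      (use assms in \<open>auto simp: v_diag_def split: node.splits if_splits\<close>)
qed

lemma generator_diagrams_subset: "n \<ge> 1 \<Longrightarrow> generator_diagrams n \<subseteq> diagrams n"
  by (auto simp: generator_diagrams_def
      intro: id_diagram e_diagram f_top_diagram f_bottom_diagram w_diagram v_diagram)

lemma concat_diagrams:
  assumes "D \<in> diagrams n" "E \<in> diagrams n"
  shows "concat_diagram n D E \<in> diagrams n"
proof -
  interpret composable n D E using assms by unfold_locales (auto simp: diagrams_iff)
  show ?thesis using assms matching_concat noncrossing_concat by (auto simp: diagrams_iff)
qed

section \<open>Rotation by a half turn\<close>

fun rot_node :: "nat \<Rightarrow> node \<Rightarrow> node" where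
  "rot_node n (Lf i) = Rt (n + 1 - i)"
| "rot_node n (Rt i) = Lf (n + 1 - i)"

fun rot_target :: "nat \<Rightarrow> 'x target \<Rightarrow> 'x target" where
  "rot_target n (ToNode q) = ToNode (rot_node n q)"
| "rot_target n (ToTop a) = ToBottom a"
| "rot_target n (ToBottom b) = ToTop b"

fun rot_vertex :: "nat \<Rightarrow> vertex \<Rightarrow> vertex" where
  "rot_vertex n (Inl p) = Inr (rot_node n p)"
| "rot_vertex n (Inr p) = Inl (rot_node n p)"

text \<open>A half turn, unlike a reflection, exchanges left with right and also top with bottom; so
  strings from the left to the top become strings from the right to the bottom.\<close>

definition rot :: "nat \<Rightarrow> 'x diagram \<Rightarrow> 'x diagram" where
  "rot n D = (\<lambda>p. if p \<in> nodes n then map_option (rot_target n) (D (rot_node n p)) else None)"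

lemma rot_node_nodes [simp]: "p \<in> nodes n \<Longrightarrow> rot_node n p \<in> nodes n"
  by (cases p) auto

lemma rot_node_rot_node [simp]: "p \<in> nodes n \<Longrightarrow> rot_node n (rot_node n p) = p"
  by (cases p) auto

lemma rot_target_eq_ToNode: "rot_target n t = ToNode q \<longleftrightarrow> (\<exists>r. t = ToNode r \<and> q = rot_node n r)"
  by (cases t) auto

lemma rot_SomeI:
  assumes "matching n D" "D p = Some t"
  shows "rot n D (rot_node n p) = Some (rot_target n t)"
  using assms matchingD(3)[OF assms] by (simp add: rot_def)

lemma rot_SomeE:
  assumes "rot n D p = Some t"
  obtains s where "D (rot_node n p) = Some s" "t = rot_target n s" "p \<in> nodes n"
  using assms by (auto simp: rot_def split: if_splits)

lemma rot_rot:
  assumes "matching n D"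
  shows "rot n (rot n D) = D"
proof
  fix p
  show "rot n (rot n D) p = D p"
  proof (cases "p \<in> nodes n")
    case True
    then obtain t where t: "D p = Some t" using matchingD(5)[OF assms] by blast
    have "rot_target n (rot_target n t) = t"
      using matchingD(4)[OF assms, of p] t by (cases t) auto
    then show ?thesis using True t by (simp add: rot_def)
  next
    case False
    then show ?thesis using matchingD(6)[OF assms] by (simp add: rot_def)
  qed
qed

lemma matching_rot:
  assumes "matching n D"
  shows "matching n (rot n D)"
  unfolding matching_def
proof (intro conjI allI impI)
  show "dom (rot n D) = nodes n"
    using matchingD(5)[OF assms, OF rot_node_nodes] by (fastforce simp: rot_def dom_def split: if_splits)
  fix p q assume "rot n D p = Some (ToNode q)"
  then obtain r where r: "D (rot_node n p) = Some (ToNode r)" "q = rot_node n r" "p \<in> nodes n"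
    by (metis rot_SomeE rot_target_eq_ToNode)
  then show "q \<noteq> p"
    using matchingD(2,4)[OF assms r(1)] rot_node_rot_node by metis
  have "rot n D (rot_node n r) = Some (rot_target n (ToNode (rot_node n p)))"
    using rot_SomeI[OF assms] matchingD(1)[OF assms r(1)] by blast
  then show "rot n D q = Some (ToNode p)" using r by simp
qed

lemma chords_bound:
  assumes "matching n D" "(x, y) \<in> chords n D"
  shows "x \<le> 2 * n + 1 \<and> y \<le> 2 * n + 1"
proof -
  obtain p t where p: "D p = Some t" "x = pos n p" "y = target_pos n t"
    using assms(2) unfolding chords_def by blast
  then show ?thesis
    using pos_bounds(2)[OF matchingD(3)[OF assms(1) p(1)]] matchingD(4)[OF assms(1), of p] pos_bounds(2)[of _ n]
    by (cases t) auto
qed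

text \<open>The half turn is the shift of the perimeter by \<open>n + 1\<close> modulo
  \<open>2 * n + 2\<close>.\<close>

definition rot_pos :: "nat \<Rightarrow> nat \<Rightarrow> nat" where
  "rot_pos n x = (if x < n + 1 then x + (n + 1) else x - (n + 1))"

lemma noncrossing_rot:
  assumes D: "matching n D" and nc: "noncrossing n D"
  shows "noncrossing n (rot n D)"
proof -
  let ?S = "chords n D \<union> (chords n D)\<inverse>"
  let ?R = "chords n (rot n D) \<union> (chords n (rot n D))\<inverse>"
  have rp: "pos n (rot_node n p) = rot_pos n (pos n p)" if "p \<in> nodes n" for p
    using that by (cases p) (auto simp: rot_pos_def)
  have R: "(rot_pos n x, rot_pos n y) \<in> ?S" if xy: "(x, y) \<in> ?R" for x y
  proof -
    obtain p t where p: "rot n D p = Some t"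
      "x = pos n p \<and> y = target_pos n t \<or> y = pos n p \<and> x = target_pos n t"
      using xy unfolding chords_def by blast
    obtain s where s: "D (rot_node n p) = Some s" "t = rot_target n s" "p \<in> nodes n"
      using rot_SomeE[OF p(1)] by blast
    have "target_pos n s = rot_pos n (target_pos n t)"
    proof (cases s)
      case (ToNode q)
      then have "q \<in> nodes n" using matchingD(4)[OF D] s(1) by blast
      then show ?thesis using rp[of "rot_node n q"] ToNode s(2) by simp
    qed (auto simp: s(2) rot_pos_def)
    then show ?thesis
      using p(2) s(1) rp[OF s(3)] unfolding chords_def by fastforce
  qed
  have False if "(a, c) \<in> ?R" "(b, d) \<in> ?R" "a < b" "b < c" "c < d" for a b c d
  proof -
    note ac = R[OF that(1)] and bd = R[OF that(2)]
    have "d \<le> 2 * n + 1" using chords_bound[OF matching_rot[OF D]] that(2) by blast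
    note that = that(3-5) this
    have r: "x < n + 1 \<and> rot_pos n x = x + (n + 1) \<or> n + 1 \<le> x \<and> rot_pos n x + (n + 1) = x" for x
      by (auto simp: rot_pos_def)
    have sym: "(y, x) \<in> ?S" if "(x, y) \<in> ?S" for x y using that by blast
    \<comment> \<open>The ends from \<open>n + 1\<close> on wrap around and come before the others.
      A cyclic shift keeps the two chords interleaved, only the order in which they are read
      changes.\<close>
    consider "d < n + 1" | "c < n + 1" "n + 1 \<le> d" | "b < n + 1" "n + 1 \<le> c" | "a < n + 1" "n + 1 \<le> b"
      | "n + 1 \<le> a" using that by linarith
    then show False
    proof cases
      case 1
      show False by (rule noncrossingD[OF nc ac bd]) (use 1 that r[of a] r[of b] r[of c] r[of d] in linarith)+
    next
      case 2
      show False by (rule noncrossingD[OF nc sym[OF bd] ac]) (use 2 that r[of a] r[of b] r[of c] r[of d] in linarith)+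
    next
      case 3
      show False by (rule noncrossingD[OF nc sym[OF ac] sym[OF bd]])
        (use 3 that r[of a] r[of b] r[of c] r[of d] in linarith)+
    next
      case 4
      show False by (rule noncrossingD[OF nc bd sym[OF ac]]) (use 4 that r[of a] r[of b] r[of c] r[of d] in linarith)+
    next
      case 5
      show False by (rule noncrossingD[OF nc ac bd]) (use 5 that r[of a] r[of b] r[of c] r[of d] in linarith)+
    qed
  qed
  then show ?thesis unfolding noncrossing_def Let_def by blast
qed

lemma rot_diagrams: "D \<in> diagrams n \<Longrightarrow> rot n D \<in> diagrams n"
  using matching_rot noncrossing_rot by (auto simp: diagrams_iff)

lemma rot_outer: "p \<in> nodes n \<Longrightarrow> rot_vertex n (outer p) = outer (rot_node n p)"
  by (cases p) auto

lemma rot_target_at: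
  assumes "matching n D" "matching n E" "target_at D E v = Some t"
  shows "target_at (rot n E) (rot n D) (rot_vertex n v) = Some (rot_target n t)"
  using assms rot_SomeI by (cases v) auto

text \<open>The factors trade places, so crossing the middle line to the right becomes crossing it
  to the left, while the flag is unaffected.\<close>

lemma trace_rot:
  assumes "trace n D E b v u t" "matching n D" "matching n E"
  shows "trace n (rot n E) (rot n D) b (rot_vertex n v) (rot_vertex n u) (rot_target n t)"
  using assms(1)
proof (induction rule: trace.induct)
  case (stop v t)
  show ?case
    by (rule trace.stop[OF rot_target_at[OF assms(2,3) stop(1)]])
      (use stop(2) in \<open>auto simp: boundary_def rot_target_eq_ToNode\<close>)
next
  case (inside v q u t)
  have "same_side (rot_vertex n v) (rot_node n q) = rot_vertex n (same_side v q)" by (cases v) auto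
  then show ?case
    using trace.inside[of "rot n E" "rot n D" "rot_vertex n v" "rot_node n q"] inside(3)
      rot_target_at[OF assms(2,3) inside(1)] by simp
next
  case (exit p)
  then show ?case using trace.exit[OF rot_node_nodes[OF exit]] rot_outer by simp
next
  case (rightwards i u t)
  then show ?case by (auto intro!: trace.leftwards)
next
  case (leftwards i u t)
  then show ?case by (auto intro!: trace.rightwards)
qed

lemma rot_concat:
  assumes D: "matching n D" and E: "matching n E"
  shows "rot n (concat_diagram n D E) = concat_diagram n (rot n E) (rot n D)"
proof
  interpret DE: composable n D E using assms by unfold_locales
  interpret ED: composable n "rot n E" "rot n D" using assms matching_rot by unfold_locales
  fix p
  show "rot n (concat_diagram n D E) p = concat_diagram n (rot n E) (rot n D) p"
  proof (cases "p \<in> nodes n")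
    case p: True
    then obtain t where t: "concat_diagram n D E (rot_node n p) = Some t"
      using DE.concat_leads_to rot_node_nodes by blast
    then obtain u where "trace n D E True (outer (rot_node n p)) u t" using DE.concat_eqD(3) by blast
    then have "concat_diagram n (rot n E) (rot n D) p = Some (rot_target n t)"
      using ED.concat_eqI[OF p] trace_rot[OF _ D E] rot_outer[OF rot_node_nodes[OF p]] p by fastforce
    then show ?thesis using t p by (simp add: rot_def)
  qed (simp add: rot_def concat_diagram_def)
qed

lemma rot_id: "rot n (id_diag n) = id_diag n"
  by (rule ext) (auto simp: rot_def id_diag_def split: node.splits)

lemma rot_e:
  assumes "1 \<le> i" "i \<le> n - 1"
  shows "rot n (e_diag n i) = (e_diag n (n - i) :: 'a diagram)"
proof
  fix p
  have *: "n + 1 - j = i \<longleftrightarrow> j = n - i + 1" "n + 1 - j = i + 1 \<longleftrightarrow> j = n - i"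
    "1 \<le> n + 1 - j" "n + 1 - j \<le> n"
    if "1 \<le> j" "j \<le> n" for j
    using that assms by auto
  have **: "n + 1 - i = n - i + 1" "n + 1 - (i + 1) = n - i" using assms by auto
  show "rot n (e_diag n i) p = (e_diag n (n - i) :: 'a diagram) p"
  proof (cases "p \<in> nodes n")
    case True
    then show ?thesis
      using * ** by (cases p) (simp_all add: rot_def e_diag_apply)
  next
    case False
    have "1 \<le> n - i" "n - i \<le> n - 1" using assms by linarith+
    then have m: "matching n (e_diag n (n - i) :: 'a diagram)"
      using e_diagram unfolding diagrams_iff by blast
    show ?thesis using False matchingD(6)[OF m False] by (simp add: rot_def)
  qed
qed

lemma rot_f_top: "n \<ge> 1 \<Longrightarrow> rot n (f_top_diag n a b) = f_bottom_diag n b a"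
proof
  fix p assume "n \<ge> 1"
  then show "rot n (f_top_diag n a b) p = f_bottom_diag n b a p"
    by (cases p) (auto simp: rot_def f_top_diag_def f_bottom_diag_def id_diag_def)
qed

lemma rot_f_bottom: "n \<ge> 1 \<Longrightarrow> rot n (f_bottom_diag n a b) = f_top_diag n b a"
  using rot_f_top rot_rot f_top_diagram unfolding diagrams_iff by metis

lemma rot_w: "n \<ge> 1 \<Longrightarrow> rot n (w_diag n a b) = w_diag n b a"
proof
  fix p assume "n \<ge> 1"
  then show "rot n (w_diag n a b) p = w_diag n b a p"
    by (cases p) (auto simp: rot_def w_diag_def)
qed

lemma rot_v: "n \<ge> 1 \<Longrightarrow> rot n (v_diag n a b) = v_diag n b a"
proof
  fix p assume "n \<ge> 1"
  then show "rot n (v_diag n a b) p = v_diag n b a p"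
    by (cases p) (auto simp: rot_def v_diag_def)
qed

lemma rot_generator:
  assumes "n \<ge> 1" "g \<in> generator_diagrams n"
  shows "rot n g \<in> generator_diagrams n"
proof -
  consider "g = id_diag n" | i where "g = e_diag n i" "1 \<le> i" "i \<le> n - 1"
    | a b where "g = f_top_diag n a b \<or> g = f_bottom_diag n a b \<or> g = w_diag n a b \<or> g = v_diag n a b"
    using assms(2) unfolding generator_diagrams_def by blast
  then show ?thesis
  proof cases
    case (2 i)
    then have "rot n g = e_diag n (n - i)" "1 \<le> n - i" "n - i \<le> n - 1" using rot_e by auto
    then show ?thesis unfolding generator_diagrams_def by blast
  next
    case (3 a b)
    then have "rot n g \<in> {f_bottom_diag n b a, f_top_diag n b a, w_diag n b a, v_diag n b a}"
      by (auto simp: rot_f_top[OF assms(1)] rot_f_bottom[OF assms(1)] rot_w[OF assms(1)] rot_v[OF assms(1)])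
    then show ?thesis unfolding generator_diagrams_def by blast
  qed (simp add: generator_diagrams_def rot_id)
qed

section \<open>Left multiplication by generators\<close>

inductive_set generated :: "nat \<Rightarrow> 'x diagram set" for n where
  base: "g \<in> generator_diagrams n \<Longrightarrow> g \<in> generated n"
| concat: "D \<in> generated n \<Longrightarrow> E \<in> generated n \<Longrightarrow> concat_diagram n D E \<in> generated n"

lemma generated_subset: "n \<ge> 1 \<Longrightarrow> generated n \<subseteq> diagrams n"
proof
  fix D assume "n \<ge> 1" "D \<in> generated n"
  from this(2) show "D \<in> diagrams n"
    by induction (use \<open>n \<ge> 1\<close> generator_diagrams_subset concat_diagrams in blast)+
qed

lemma rot_generated:
  assumes n: "n \<ge> 1" and "D \<in> generated n"
  shows "rot n D \<in> generated n"
  using assms(2)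
proof induction
  case (base g)
  then show ?case using rot_generator[OF n] generated.base by blast
next
  case (concat D E)
  then have "matching n D" "matching n E" using generated_subset[OF n] diagrams_iff by blast+
  then show ?case using concat rot_concat generated.concat by metis
qed

section \<open>Reading off the strings of a product\<close>

context composable
begin

text \<open>Drops the last vertex of the trace, which matters for planarity but not for computing a
  product.\<close>

definition leads :: "vertex \<Rightarrow> 'x target \<Rightarrow> bool" where
  "leads v t \<longleftrightarrow> (\<exists>u. trace n D E True v u t)"

lemma concat_leads: "p \<in> nodes n \<Longrightarrow> leads (outer p) t \<Longrightarrow> concat_diagram n D E p = Some t"
  using concat_eqI unfolding leads_def by blast

lemma leads_left_stop:
  assumes "D p = Some t" "\<And>k. t \<noteq> ToNode (Rt k)"
  shows "leads (Inl p) t"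
proof (cases "boundary t")
  case True
  then show ?thesis using trace.stop[of D E "Inl p" t] assms unfolding leads_def by auto
next
  case False
  then obtain k where t: "t = ToNode (Lf k)" using assms(2) unfolding boundary_def by (metis node.exhaust)
  then have k: "Lf k \<in> nodes n" using matchingD(4)[OF D] assms(1) by blast
  have "trace n D E False (same_side (Inl p) (Lf k)) (outer (Lf k)) (ToNode (Lf k))"
    using trace.exit[OF k] by simp
  then show ?thesis using trace.inside[of D E "Inl p" "Lf k"] assms(1) t unfolding leads_def by auto
qed

lemma leads_right_stop:
  assumes "E p = Some t" "\<And>k. t \<noteq> ToNode (Lf k)"
  shows "leads (Inr p) t"
proof (cases "boundary t")
  case True
  then show ?thesis using trace.stop[of D E "Inr p" t] assms unfolding leads_def by auto
next
  case False
  then obtain k where t: "t = ToNode (Rt k)" using assms(2) unfolding boundary_def by (metis node.exhaust)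
  then have k: "Rt k \<in> nodes n" using matchingD(4)[OF E] assms(1) by blast
  have "trace n D E False (same_side (Inr p) (Rt k)) (outer (Rt k)) (ToNode (Rt k))"
    using trace.exit[OF k] by simp
  then show ?thesis using trace.inside[of D E "Inr p" "Rt k"] assms(1) t unfolding leads_def by auto
qed

lemma leads_left_step:
  assumes "D p = Some (ToNode (Rt k))" "leads (Inr (Lf k)) t"
  shows "leads (Inl p) t"
proof -
  obtain u where u: "trace n D E True (Inr (Lf k)) u t" using assms(2) unfolding leads_def by blast
  have "k \<in> {1..n}" using matchingD(4)[OF D assms(1)] by simp
  then have "trace n D E False (same_side (Inl p) (Rt k)) u t" using trace.rightwards u by simp
  then show ?thesis using trace.inside[of D E "Inl p" "Rt k"] assms(1) unfolding leads_def by auto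
qed

lemma leads_right_step:
  assumes "E p = Some (ToNode (Lf k))" "leads (Inl (Rt k)) t"
  shows "leads (Inr p) t"
proof -
  obtain u where u: "trace n D E True (Inl (Rt k)) u t" using assms(2) unfolding leads_def by blast
  have "k \<in> {1..n}" using matchingD(4)[OF E assms(1)] by simp
  then have "trace n D E False (same_side (Inr p) (Lf k)) u t" using trace.leftwards u by simp
  then show ?thesis using trace.inside[of D E "Inr p" "Lf k"] assms(1) unfolding leads_def by auto
qed

lemma concat_Lf_own:
  assumes "D (Lf j) = Some t" "\<And>k. t \<noteq> ToNode (Rt k)"
  shows "concat_diagram n D E (Lf j) = Some t"
  using concat_leads[of "Lf j" t] leads_left_stop[OF assms] matchingD(3)[OF D assms(1)]
  by (simp del: nodes_simps)

lemma concat_Lf_step: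
  assumes "D (Lf j) = Some (ToNode (Rt k))" "leads (Inr (Lf k)) t"
  shows "concat_diagram n D E (Lf j) = Some t"
  using concat_leads[of "Lf j" t] leads_left_step[OF assms] matchingD(3)[OF D assms(1)]
  by (simp del: nodes_simps)

lemma concat_Rt_own:
  assumes "E (Rt j) = Some t" "\<And>k. t \<noteq> ToNode (Lf k)"
  shows "concat_diagram n D E (Rt j) = Some t"
  using concat_leads[of "Rt j" t] leads_right_stop[OF assms] matchingD(3)[OF E assms(1)]
  by (simp del: nodes_simps)

text \<open>Covers a string that enters the right factor and returns to the left one at most once.
  In the products below these are all strings but the few that meet the arc or boundary string being
  moved; those are traced step by step.\<close>

lemma leads_right_cases:
  assumes "E (Lf k) = Some t"
    and "\<And>m. t = ToNode (Lf m) \<Longrightarrow> \<exists>s. D (Rt m) = Some s \<and> (\<forall>l. s \<noteq> ToNode (Rt l)) \<and> t' = s"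
    and "\<forall>m. t \<noteq> ToNode (Lf m) \<Longrightarrow> t' = t"
  shows "leads (Inr (Lf k)) t'"
proof (cases "\<exists>m. t = ToNode (Lf m)")
  case True
  then obtain m where "t = ToNode (Lf m)" by blast
  then show ?thesis using assms(1,2) leads_right_step leads_left_stop by blast
next
  case False
  then show ?thesis using leads_right_stop assms by blast
qed

end

text \<open>In a matching a string is known from either end, so a through string is checked at its
  left end and an arc on the left at one end of choice.\<close>

lemma diagram_eqI:
  assumes C: "matching n C" and D: "matching n D"
    and left: "\<And>j t. D (Lf j) = Some t \<Longrightarrow>
        C (Lf j) = Some t \<or> (\<exists>m. t = ToNode (Lf m) \<and> C (Lf m) = Some (ToNode (Lf j)))"
    and right: "\<And>j t. D (Rt j) = Some t \<Longrightarrow> (\<And>k. t \<noteq> ToNode (Lf k)) \<Longrightarrow> C (Rt j) = Some t"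
  shows "C = D"
proof
  fix p
  show "C p = D p"
  proof (cases "p \<in> nodes n")
    case False
    then show ?thesis using matchingD(6)[OF C] matchingD(6)[OF D] by simp
  next
    case True
    then obtain t where t: "D p = Some t" using matchingD(5)[OF D] by blast
    have L: "C (Lf j) = Some s" if "D (Lf j) = Some s" for j s
      using left[OF that] matchingD(1)[OF C] by blast
    show ?thesis
    proof (cases p)
      case (Lf j)
      then show ?thesis using L t by simp
    next
      case (Rt j)
      show ?thesis
      proof (cases "\<exists>k. t = ToNode (Lf k)")
        case True
        then obtain k where k: "t = ToNode (Lf k)" by blast
        then have "D (Lf k) = Some (ToNode p)" using matchingD(1)[OF D] t by blast
        then have "C p = Some (ToNode (Lf k))" using L matchingD(1)[OF C] by blast
        then show ?thesis using t k by simp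
      next
        case False
        then show ?thesis using right t Rt by simp
      qed
    qed
  qed
qed

text \<open>Right nodes take care of themselves: a string of \<open>D\<close> that avoids the left
  nodes of \<open>D\<close> is untouched by both multiplications.\<close>

lemma concat_concat_eqI:
  assumes g: "matching n g" and h: "matching n h" and D: "matching n D"
    and left: "\<And>j t. D (Lf j) = Some t \<Longrightarrow>
        concat_diagram n g (concat_diagram n h D) (Lf j) = Some t \<or>
        (\<exists>m. t = ToNode (Lf m) \<and> concat_diagram n g (concat_diagram n h D) (Lf m) = Some (ToNode (Lf j)))"
  shows "concat_diagram n g (concat_diagram n h D) = D"
proof -
  interpret h: composable n h D using h D by unfold_locales
  interpret g: composable n g "concat_diagram n h D" using g h.matching_concat by unfold_locales
  show ?thesis
    by (rule diagram_eqI[OF g.matching_concat D left])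
      (auto intro: g.concat_Rt_own h.concat_Rt_own)
qed

section \<open>The reversible moves and their measure\<close>

definition tops :: "nat \<Rightarrow> 'x diagram \<Rightarrow> nat set" where
  "tops n D = {j \<in> {1..n}. \<exists>a. D (Lf j) = Some (ToTop a)}"

lemma finite_tops [simp]: "finite (tops n D)"
  by (simp add: tops_def)

lemma card_tops: "card (tops n D) \<le> n"
proof -
  have "tops n D \<subseteq> {1..n}" by (auto simp: tops_def)
  then show ?thesis using card_mono[of "{1..n}" "tops n D"] by simp
qed

lemma f_top_apply:
  "f_top_diag n a b (Lf j) = (if j = 1 then Some (ToTop a)
    else if 1 \<le> j \<and> j \<le> n then Some (ToNode (Rt j)) else None)"
  "f_top_diag n a b (Rt j) = (if j = 1 then Some (ToTop b)
    else if 1 \<le> j \<and> j \<le> n then Some (ToNode (Lf j)) else None)"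
  by (simp_all add: f_top_diag_def id_diag_def)

lemma e_matching: "1 \<le> i \<Longrightarrow> i + 1 \<le> n \<Longrightarrow> matching n (e_diag n i)"
  by (rule e_diagram[unfolded diagrams_iff, THEN conjunct1]) auto

text \<open>\<open>e i\<close> brings its own arc to \<open>i\<close> and \<open>i + 1\<close> and
  diverts the former string of \<open>i\<close> over the old arc to \<open>i + 2\<close>.
  \<open>e (i + 1)\<close> restores the arc and leads node \<open>i\<close> back to that
  string.\<close>

lemma move_arc_up:
  fixes D :: "'x diagram"
  assumes D: "matching n D" and i: "1 \<le> i" "i + 2 \<le> n"
    and arc: "D (Lf (i + 1)) = Some (ToNode (Lf (i + 2)))"
  defines "D' \<equiv> concat_diagram n (e_diag n i) D"
  shows "D' (Lf i) = Some (ToNode (Lf (i + 1)))" "concat_diagram n (e_diag n (i + 1)) D' = D"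
    "card (tops n D) \<le> card (tops n D')"
proof -
  have e: "matching n (e_diag n i :: 'x diagram)" "matching n (e_diag n (i + 1) :: 'x diagram)"
    by (rule e_matching; use i in simp)+
  interpret h: composable n "e_diag n i" D using e D by unfold_locales
  interpret g: composable n "e_diag n (i + 1)" D'
    using e h.matching_concat unfolding D'_def by unfold_locales
  have arc': "D (Lf (i + 2)) = Some (ToNode (Lf (i + 1)))" using matchingD(1)[OF D arc] .
  have avoid: "m \<noteq> i + 1 \<and> m \<noteq> i + 2 \<and> m \<noteq> j \<and> 1 \<le> m \<and> m \<le> n"
    if "D (Lf j) = Some (ToNode (Lf m))" "j \<noteq> i + 1" "j \<noteq> i + 2" for j m
    using matchingD(1,2,4)[OF D that(1)] arc arc' that by auto
  show D'i: "D' (Lf i) = Some (ToNode (Lf (i + 1)))"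
    unfolding D'_def by (rule h.concat_Lf_own) (auto simp: e_diag_apply)
  obtain t where t: "D (Lf i) = Some t" using matchingD(5)[OF D, of "Lf i"] i by auto
  have leads_t: "h.leads (Inr (Lf i)) t"
    by (rule h.leads_right_cases[OF t]) (use avoid[of i] t in \<open>auto simp: e_diag_apply\<close>)
  have D'2: "D' (Lf (i + 2)) = Some t"
    unfolding D'_def
    by (rule h.concat_Lf_step[of _ "i + 2", OF _ h.leads_right_step[OF arc' h.leads_left_step[of _ i, OF _ leads_t]]])
      (use i in \<open>auto simp: e_diag_apply\<close>)
  \<comment> \<open>An arc of \<open>D\<close> from \<open>j\<close> to \<open>i\<close> ends at
    \<open>i + 2\<close> in \<open>D'\<close>, whence the exclusion of
    \<open>ToNode (Lf i)\<close>.\<close>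
  have D'j: "D' (Lf j) = Some s"
    if j: "D (Lf j) = Some s" "j \<noteq> i" "j \<noteq> i + 1" "j \<noteq> i + 2" "s \<noteq> ToNode (Lf i)" for j s
  proof -
    have jn: "1 \<le> j" "j \<le> n" using matchingD(3)[OF D j(1)] by auto
    have "h.leads (Inr (Lf j)) s"
      by (rule h.leads_right_cases[OF j(1)]) (use avoid[of j] j in \<open>auto simp: e_diag_apply\<close>)
    then show ?thesis unfolding D'_def
      by (rule h.concat_Lf_step[of _ j, rotated]) (use jn j in \<open>auto simp: e_diag_apply\<close>)
  qed
  \<comment> \<open>The path: through to \<open>i\<close> in \<open>D'\<close>, along its arc to
    \<open>i + 1\<close>, over the right arc of \<open>e (i + 1)\<close> to \<open>i + 2\<close>,
    and on along the diverted string.\<close>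
  have L: "concat_diagram n (e_diag n (i + 1)) D' (Lf i) = Some t"
  proof -
    have "g.leads (Inr (Lf (i + 2))) t"
      by (rule g.leads_right_cases[OF D'2]) (use avoid[of i] t in \<open>auto simp: e_diag_apply\<close>)
    then have "g.leads (Inl (Rt (i + 1))) t"
      by (rule g.leads_left_step[rotated]) (auto simp: e_diag_apply)
    then have "g.leads (Inr (Lf i)) t" by (rule g.leads_right_step[OF D'i])
    then show ?thesis
      by (rule g.concat_Lf_step[rotated]) (use i in \<open>auto simp: e_diag_apply\<close>)
  qed
  show "concat_diagram n (e_diag n (i + 1)) D' = D"
    unfolding D'_def
  proof (rule concat_concat_eqI[OF e(2,1) D], fold D'_def)
    fix j s assume j: "D (Lf j) = Some s"
    then have jn: "1 \<le> j" "j \<le> n" using matchingD(3)[OF D j(1)] by auto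
    consider "j = i + 1 \<or> j = i + 2" | "j = i"
      | "j \<noteq> i" "j \<noteq> i + 1" "j \<noteq> i + 2" "s \<noteq> ToNode (Lf i)"
      | "j \<noteq> i" "j \<noteq> i + 1" "j \<noteq> i + 2" "s = ToNode (Lf i)" by blast
    then show "concat_diagram n (e_diag n (i + 1)) D' (Lf j) = Some s \<or>
      (\<exists>m. s = ToNode (Lf m) \<and> concat_diagram n (e_diag n (i + 1)) D' (Lf m) = Some (ToNode (Lf j)))"
    proof cases
      case 1
      then have "concat_diagram n (e_diag n (i + 1)) D' (Lf j) = Some s"
        by (intro g.concat_Lf_own) (use j arc arc' in \<open>auto simp: e_diag_apply\<close>)
      then show ?thesis ..
    next
      case 3
      have "g.leads (Inr (Lf j)) s"
        by (rule g.leads_right_cases[OF D'j[OF j 3]]) (use avoid[of j] j 3 in \<open>auto simp: e_diag_apply\<close>)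
      then have "concat_diagram n (e_diag n (i + 1)) D' (Lf j) = Some s"
        by (rule g.concat_Lf_step[of _ j, rotated]) (use jn 3 in \<open>auto simp: e_diag_apply\<close>)
      then show ?thesis ..
    next
      case 2
      then show ?thesis using L t j by simp
    next
      case 4
      \<comment> \<open>This arc is checked at its other end \<open>i\<close>, where the path has
        been traced.\<close>
      then have "D (Lf i) = Some (ToNode (Lf j))" using matchingD(1)[OF D] j by blast
      then show ?thesis using L t 4 by auto
    qed
  qed
  \<comment> \<open>\<open>s\<close> follows the diverted string from \<open>i\<close> to
    \<open>i + 2\<close>; the value at \<open>i + 2\<close> is chosen to make \<open>s\<close>
    injective.\<close>
  define s where "s j = (if j = i then i + 2 else if j = i + 2 then i else j)" for j
  have "s ` tops n D \<subseteq> tops n D'"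
  proof
    fix k assume "k \<in> s ` tops n D"
    then obtain j a where j: "k = s j" "1 \<le> j" "j \<le> n" "D (Lf j) = Some (ToTop a)"
      unfolding tops_def by auto
    have "j \<noteq> i + 1" "j \<noteq> i + 2" using j arc arc' by auto
    moreover have "D' (Lf (s j)) = Some (ToTop a)"
      using D'j[OF j(4)] D'2 t j(4) calculation by (cases "j = i") (auto simp: s_def)
    ultimately show "k \<in> tops n D'" using j i by (auto simp: tops_def s_def)
  qed
  moreover have "inj_on s (tops n D)" by (rule inj_onI) (auto simp: s_def split: if_splits)
  ultimately show "card (tops n D) \<le> card (tops n D')"
    by (meson card_inj_on_le finite_tops)
qed

text \<open>In \<open>D'\<close> node 1 runs to the top in \<open>f\<close>, and node 2 follows the
  old arc back to right node 1 of \<open>f\<close>, hence to the top as well. Multiplication by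
  \<open>e 1\<close> joins these two strings to a boundary arc, which is removed; so both labels are
  arbitrary.\<close>

lemma arc_to_tops:
  fixes D :: "'x diagram" and a b :: 'x
  assumes D: "matching n D" and n: "2 \<le> n" and arc: "D (Lf 1) = Some (ToNode (Lf 2))"
  defines "D' \<equiv> concat_diagram n (f_top_diag n a b) D"
  shows "concat_diagram n (e_diag n 1) D' = D" "card (tops n D) < card (tops n D')"
proof -
  have e: "matching n (e_diag n 1 :: 'x diagram)" "matching n (f_top_diag n a b)"
    using e_matching[of 1 n] f_top_diagram[of n a b] n by (simp_all add: diagrams_iff e_matching)
  interpret h: composable n "f_top_diag n a b" D using e D by unfold_locales
  interpret g: composable n "e_diag n 1" D'
    using e h.matching_concat unfolding D'_def by unfold_locales
  have arc': "D (Lf 2) = Some (ToNode (Lf 1))" using matchingD(1)[OF D arc] .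
  have avoid: "m \<noteq> 1 \<and> m \<noteq> 2 \<and> 1 \<le> m \<and> m \<le> n"
    if "D (Lf j) = Some (ToNode (Lf m))" "j \<noteq> 1" "j \<noteq> 2" for j m
    using matchingD(1,2,4)[OF D that(1)] arc arc' that by auto
  have D'1: "D' (Lf 1) = Some (ToTop a)"
    unfolding D'_def by (rule h.concat_Lf_own) (auto simp: f_top_apply)
  have "h.leads (Inl (Rt 1)) (ToTop b)" by (rule h.leads_left_stop) (auto simp: f_top_apply)
  then have "h.leads (Inr (Lf 2)) (ToTop b)" by (rule h.leads_right_step[OF arc'])
  then have D'2: "D' (Lf 2) = Some (ToTop b)"
    unfolding D'_def by (rule h.concat_Lf_step[rotated]) (use n in \<open>auto simp: f_top_apply\<close>)
  have D'j: "D' (Lf j) = Some s" if j: "D (Lf j) = Some s" "j \<noteq> 1" "j \<noteq> 2" for j s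
  proof -
    have jn: "1 \<le> j" "j \<le> n" using matchingD(3)[OF D j(1)] by auto
    have "h.leads (Inr (Lf j)) s"
      by (rule h.leads_right_cases[OF j(1)]) (use avoid[of j] j in \<open>auto simp: f_top_apply\<close>)
    then show ?thesis unfolding D'_def
      by (rule h.concat_Lf_step[of _ j, rotated]) (use jn j in \<open>auto simp: f_top_apply\<close>)
  qed
  show "concat_diagram n (e_diag n 1) D' = D"
    unfolding D'_def
  proof (rule concat_concat_eqI[OF e D], fold D'_def)
    fix j s assume j: "D (Lf j) = Some s"
    then have jn: "1 \<le> j" "j \<le> n" using matchingD(3)[OF D j(1)] by auto
    have "concat_diagram n (e_diag n 1) D' (Lf j) = Some s"
    proof (cases "j = 1 \<or> j = 2")
      case True
      then show ?thesis
        by (intro g.concat_Lf_own) (use j arc arc' in \<open>auto simp: e_diag_apply\<close>)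
    next
      case False
      have "g.leads (Inr (Lf j)) s"
        by (rule g.leads_right_cases[OF D'j[OF j]]) (use avoid[of j] j False in \<open>auto simp: e_diag_apply\<close>)
      then show ?thesis
        by (rule g.concat_Lf_step[of _ j, rotated]) (use jn False in \<open>auto simp: e_diag_apply\<close>)
    qed
    then show "concat_diagram n (e_diag n 1) D' (Lf j) = Some s \<or>
      (\<exists>m. s = ToNode (Lf m) \<and> concat_diagram n (e_diag n 1) D' (Lf m) = Some (ToNode (Lf j)))" ..
  qed
  have "1 \<notin> tops n D" using arc by (simp add: tops_def)
  have "j \<in> tops n D'" if "j \<in> insert 1 (tops n D)" for j
    using that D'1 D'2 D'j[of j] n by (cases "j = 1 \<or> j = 2") (auto simp: tops_def)
  then have "insert 1 (tops n D) \<subseteq> tops n D'" by blast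
  then show "card (tops n D) < card (tops n D')"
    using card_mono[of "tops n D'" "insert 1 (tops n D)"] \<open>1 \<notin> tops n D\<close> by simp
qed

text \<open>\<open>w\<close> moves the strings down by one node, which frees node 1 for a string to
  the top, and closes the bottom string at \<open>n\<close> against its own to a boundary arc.
  \<open>v\<close> moves everything back and supplies a new bottom string, so its lower label has to
  be \<open>b\<close>, while \<open>a\<close> and \<open>c\<close> are arbitrary.\<close>

lemma bottom_to_top:
  fixes D :: "'x diagram" and a b c :: 'x
  assumes D: "matching n D" and n: "1 \<le> n" and bot: "D (Lf n) = Some (ToBottom b)"
  defines "D' \<equiv> concat_diagram n (w_diag n a c) D"
  shows "concat_diagram n (v_diag n a b) D' = D" "card (tops n D) < card (tops n D')"
proof -
  have e: "matching n (v_diag n a b)" "matching n (w_diag n a c)"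
    using v_diagram[of n a b] w_diagram[of n a c] n by (auto simp: diagrams_iff)
  interpret h: composable n "w_diag n a c" D using e D by unfold_locales
  interpret g: composable n "v_diag n a b" D'
    using e h.matching_concat unfolding D'_def by unfold_locales
  have avoid: "m \<noteq> n \<and> 1 \<le> m \<and> m \<le> n" if "D (Lf j) = Some (ToNode (Lf m))" for j m
    using matchingD(1,4)[OF D that(1)] bot by auto
  have D'1: "D' (Lf 1) = Some (ToTop a)"
    unfolding D'_def by (rule h.concat_Lf_own) (use n in \<open>auto simp: w_diag_def\<close>)
  \<comment> \<open>Left partners are renumbered by the shift that \<open>w\<close>
    performs.\<close>
  define up where "up s = (case s of ToNode (Lf m) \<Rightarrow> ToNode (Lf (m + 1)) | _ \<Rightarrow> s)" for s :: "'x target"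
  have D'j: "D' (Lf (j + 1)) = Some (up s)" if j: "D (Lf j) = Some s" "j \<noteq> n" for j s
  proof -
    have jn: "1 \<le> j" "j < n" using matchingD(3)[OF D j(1)] j(2) by auto
    have "h.leads (Inr (Lf j)) (up s)"
      by (rule h.leads_right_cases[OF j(1)])
        (use avoid[of j] j in \<open>auto simp: w_diag_def up_def split: target.splits node.splits\<close>)
    then show ?thesis unfolding D'_def
      by (rule h.concat_Lf_step[of _ j, rotated]) (use jn in \<open>auto simp: w_diag_def\<close>)
  qed
  show "concat_diagram n (v_diag n a b) D' = D"
    unfolding D'_def
  proof (rule concat_concat_eqI[OF e D], fold D'_def)
    fix j s assume j: "D (Lf j) = Some s"
    then have jn: "1 \<le> j" "j \<le> n" using matchingD(3)[OF D j(1)] by auto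
    have "concat_diagram n (v_diag n a b) D' (Lf j) = Some s"
    proof (cases "j = n")
      case True
      then show ?thesis
        by (intro g.concat_Lf_own) (use j bot n in \<open>auto simp: v_diag_def\<close>)
    next
      case False
      have "g.leads (Inr (Lf (j + 1))) s"
        by (rule g.leads_right_cases[OF D'j[OF j False]])
          (use avoid[of j] j False in \<open>auto simp: v_diag_def up_def split: target.splits node.splits\<close>)
      then show ?thesis
        by (rule g.concat_Lf_step[rotated]) (use jn False in \<open>auto simp: v_diag_def\<close>)
    qed
    then show "concat_diagram n (v_diag n a b) D' (Lf j) = Some s \<or>
      (\<exists>m. s = ToNode (Lf m) \<and> concat_diagram n (v_diag n a b) D' (Lf m) = Some (ToNode (Lf j)))" ..
  qed
  have "j \<in> tops n D'" if j: "j \<in> insert 1 (Suc ` tops n D)" for j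
  proof (cases "j = 1")
    case True
    then show ?thesis using D'1 n by (simp add: tops_def)
  next
    case False
    then obtain k x where k: "j = k + 1" "1 \<le> k" "k \<le> n" "D (Lf k) = Some (ToTop x)"
      using j by (auto simp: tops_def)
    then have "k \<noteq> n" using bot by auto
    then show ?thesis using D'j[OF k(4)] k by (auto simp: tops_def up_def)
  qed
  then have "insert 1 (Suc ` tops n D) \<subseteq> tops n D'" by blast
  moreover have "1 \<notin> Suc ` tops n D" by (auto simp: tops_def)
  ultimately show "card (tops n D) < card (tops n D')"
    using card_mono[of "tops n D'" "insert 1 (Suc ` tops n D)"] by (simp add: card_image)
qed

section \<open>Reduction to diagrams without returning strings\<close>

text \<open>An innermost arc joins neighbours: if \<open>k\<close> is not \<open>j + 1\<close>, then
  node \<open>j + 1\<close> is enclosed by the arc from \<open>j\<close> to \<open>k\<close>, and by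
  planarity its string is a shorter arc inside.\<close>

lemma exists_adjacent_arc:
  assumes "D \<in> diagrams n" "D (Lf j) = Some (ToNode (Lf k))"
  shows "\<exists>i\<ge>1. D (Lf i) = Some (ToNode (Lf (i + 1)))"
proof -
  have D: "matching n D" and nc: "noncrossing n D" using assms(1) by (auto simp: diagrams_iff)
  have arc: "\<exists>i\<ge>1. D (Lf i) = Some (ToNode (Lf (i + 1)))"
    if "D (Lf j) = Some (ToNode (Lf k))" "j < k" for j k
    using that
  proof (induction "k - j" arbitrary: j k rule: less_induct)
    case less
    note jk = less.prems
    have j: "1 \<le> j" "k \<le> n" using matchingD(3,4)[OF D jk(1)] by auto
    have kj: "D (Lf k) = Some (ToNode (Lf j))" using matchingD(1)[OF D jk(1)] .
    show ?case
    proof (cases "k = j + 1")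
      case True
      then show ?thesis using jk j by blast
    next
      case False
      then obtain t where t: "D (Lf (j + 1)) = Some t"
        using matchingD(5)[OF D, of "Lf (j + 1)"] jk j by auto
      have "t \<noteq> ToNode (Lf j)" "t \<noteq> ToNode (Lf k)"
        using matchingD(1)[OF D, of "Lf (j + 1)"] t jk kj False by fastforce+
      then have neq: "target_pos n t \<noteq> j" "target_pos n t \<noteq> k"
        using target_pos_node[OF D t, of "Lf j"] target_pos_node[OF D t, of "Lf k"] jk j by auto
      have "\<not> target_pos n t < j"
        using noncrossing_strings[OF nc t jk(1), of "target_pos n t" "j + 1" j k] jk False by auto
      moreover have "\<not> k < target_pos n t"
        using noncrossing_strings[OF nc jk(1) t, of j k "j + 1" "target_pos n t"] jk False by auto
      ultimately have tp: "j < target_pos n t" "target_pos n t < k" using neq by auto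
      obtain m where m: "t = ToNode (Lf m)"
      proof (cases t)
        case (ToNode q)
        then have "q \<in> nodes n" using matchingD(4)[OF D] t by blast
        then show ?thesis using ToNode tp j that by (cases q) auto
      qed (use tp j in auto)
      then have "m \<noteq> j + 1" using matchingD(2)[OF D, of "Lf (j + 1)"] t by auto
      then show ?thesis
        using less.hyps[of m "j + 1"] t m tp by auto
    qed
  qed
  have "D (Lf k) = Some (ToNode (Lf j))" "k \<noteq> j"
    using matchingD(1,2)[OF D assms(2)] by auto
  then show ?thesis using arc[OF assms(2)] arc[of k j] by (cases "j < k") auto
qed

text \<open>A string from \<open>j\<close> to the bottom shuts the last left node off from the top
  and from the right side; with arcs excluded, only the bottom remains.\<close>

lemma last_node_bottom:
  assumes "D \<in> diagrams n" "D (Lf j) = Some (ToBottom b)"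
    and no_arc: "\<And>k. D (Lf n) \<noteq> Some (ToNode (Lf k))"
  shows "\<exists>b. D (Lf n) = Some (ToBottom b)"
proof -
  have D: "matching n D" and nc: "noncrossing n D" using assms(1) by (auto simp: diagrams_iff)
  have j: "1 \<le> j" "j \<le> n" using matchingD(3)[OF D assms(2)] by auto
  obtain t where t: "D (Lf n) = Some t" using matchingD(5)[OF D, of "Lf n"] j by auto
  show ?thesis
  proof (cases "j = n")
    case True
    then show ?thesis using assms(2) by blast
  next
    case False
    show ?thesis
    proof (cases t)
      case (ToNode q)
      then obtain k where k: "q = Rt k" using no_arc t by (cases q) auto
      then have "k \<le> n" using matchingD(4)[OF D, of "Lf n" "Rt k"] t ToNode by simp
      then have "n + 1 < 2 * n + 2 - k" by simp
      then have False
        using noncrossing_strings[OF nc assms(2) t, of j "n + 1" n "2 * n + 2 - k"] j False k ToNode by auto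
      then show ?thesis ..
    next
      case (ToTop a)
      then have False
        using noncrossing_strings[OF nc t assms(2), of 0 n j "n + 1"] j False by auto
      then show ?thesis ..
    qed (use t in blast)
  qed
qed

definition left_reduced :: "'x diagram \<Rightarrow> bool" where
  "left_reduced D \<longleftrightarrow>
     (\<forall>j t. D (Lf j) = Some t \<longrightarrow> (\<exists>a. t = ToTop a) \<or> (\<exists>k. t = ToNode (Rt k)))"

definition right_reduced :: "'x diagram \<Rightarrow> bool" where
  "right_reduced D \<longleftrightarrow>
     (\<forall>j t. D (Rt j) = Some t \<longrightarrow> (\<exists>b. t = ToBottom b) \<or> (\<exists>k. t = ToNode (Lf k)))"

text \<open>A forbidden string at a right node of \<open>D\<close> avoids the left nodes, so it
  would persist in the product.\<close>

lemma right_reduced_factor: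
  assumes "matching n g" "matching n D" "right_reduced (concat_diagram n g D)"
  shows "right_reduced D"
proof -
  interpret composable n g D using assms by unfold_locales
  show ?thesis
    using assms(3) concat_Rt_own unfolding right_reduced_def by metis
qed

text \<open>The bound \<open>c\<close> stays fixed while the arc travels up, since this does not
  lower the number of top strings. Cutting the arc at node 1 raises the number above
  \<open>c\<close>, and then \<open>IH\<close> applies.\<close>

lemma left_arc_generated:
  fixes D :: "'x diagram"
  assumes n: "n \<ge> 1"
    and P: "\<And>g D. g \<in> generator_diagrams n \<Longrightarrow> D \<in> diagrams n \<Longrightarrow> P (concat_diagram n g D) \<Longrightarrow> P D"
    and IH: "\<And>D. D \<in> diagrams n \<Longrightarrow> P D \<Longrightarrow> c < card (tops n D) \<Longrightarrow> D \<in> generated n"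
  shows "D \<in> diagrams n \<Longrightarrow> P D \<Longrightarrow> c \<le> card (tops n D) \<Longrightarrow> 1 \<le> i \<Longrightarrow>
    D (Lf i) = Some (ToNode (Lf (i + 1))) \<Longrightarrow> D \<in> generated n"
proof (induction i arbitrary: D)
  case (Suc k)
  have D: "matching n D" using Suc.prems(1) by (simp add: diagrams_iff)
  have kn: "k + 2 \<le> n" using matchingD(4)[OF D Suc.prems(5)] by simp
  have gen_e: "e_diag n i \<in> (generator_diagrams n :: 'x diagram set)" if "1 \<le> i" "i + 1 \<le> n" for i
    using that unfolding generator_diagrams_def by auto
  show ?case
  proof (cases "k = 0")
    case True
    fix a :: 'x
    have gen_f: "f_top_diag n a a \<in> generator_diagrams n" unfolding generator_diagrams_def by blast
    let ?D = "concat_diagram n (f_top_diag n a a) D"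
    have D': "?D \<in> diagrams n"
      using concat_diagrams Suc.prems(1) generator_diagrams_subset[OF n] gen_f by blast
    have e: "e_diag n 1 \<in> (generator_diagrams n :: 'x diagram set)" using gen_e kn True by simp
    have arc: "D (Lf 1) = Some (ToNode (Lf 2))" using Suc.prems(5) True by (simp add: numeral_2_eq_2)
    have n2: "2 \<le> n" using kn by simp
    note eq = arc_to_tops[OF D n2 arc, of a a]
    have "P ?D" using P[OF e D'] eq Suc.prems(2) by simp
    then have "?D \<in> generated n" using IH[OF D'] eq Suc.prems(3) by simp
    then show ?thesis using generated.concat[OF generated.base[OF e]] eq by metis
  next
    case False
    let ?D = "concat_diagram n (e_diag n k) D"
    have k: "1 \<le> k" "D (Lf (k + 1)) = Some (ToNode (Lf (k + 2)))" using False Suc.prems(5) by auto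
    have D': "?D \<in> diagrams n"
      using concat_diagrams Suc.prems(1) generator_diagrams_subset[OF n] gen_e[of k] k kn by auto
    have e: "e_diag n (k + 1) \<in> (generator_diagrams n :: 'x diagram set)" using gen_e kn by simp
    note eq = move_arc_up[OF D k(1) kn k(2)]
    have "P ?D" using P[OF e D'] eq Suc.prems(2) by simp
    then have "?D \<in> generated n"
      using Suc.IH[OF D' _ _ k(1) eq(1)] eq(3) Suc.prems(3) by simp
    then show ?thesis using generated.concat[OF generated.base[OF e]] eq(2) by metis
  qed
qed simp

text \<open>\<open>P\<close> has to pass from a product to its right factor because each move is
  undone by a left multiplication: \<open>D\<close> is a generator times the reduced diagram, which
  thereby inherits \<open>P\<close>. The parameter allows one reduction with no constraint and one
  that keeps the right side reduced.\<close>

lemma left_reduction: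
  fixes D :: "'x diagram"
  assumes n: "n \<ge> 1"
    and P: "\<And>g D. g \<in> generator_diagrams n \<Longrightarrow> D \<in> diagrams n \<Longrightarrow> P (concat_diagram n g D) \<Longrightarrow> P D"
    and base: "\<And>D. D \<in> diagrams n \<Longrightarrow> P D \<Longrightarrow> left_reduced D \<Longrightarrow> D \<in> generated n"
  shows "D \<in> diagrams n \<Longrightarrow> P D \<Longrightarrow> D \<in> generated n"
proof (induction "n - card (tops n D)" arbitrary: D rule: less_induct)
  case less
  have D: "matching n D" using less.prems(1) by (simp add: diagrams_iff)
  have IH: "E \<in> generated n" if "E \<in> diagrams n" "P E" "card (tops n D) < card (tops n E)" for E
    using less.hyps[of E] that card_tops[of n E] by linarith
  show ?case
  proof (cases "\<exists>j k. D (Lf j) = Some (ToNode (Lf k))")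
    case True
    then obtain i where i: "1 \<le> i" "D (Lf i) = Some (ToNode (Lf (i + 1)))"
      using exists_adjacent_arc less.prems(1) by blast
    show ?thesis
    proof (rule left_arc_generated[where P = P, OF n])
      show "P E" if "g \<in> generator_diagrams n" "E \<in> diagrams n" "P (concat_diagram n g E)" for g E
        using P that by blast
      show "E \<in> generated n" if "E \<in> diagrams n" "P E" "card (tops n D) < card (tops n E)" for E
        using IH that by blast
    qed (use less.prems i in simp_all)
  next
    case no_arc: False
    show ?thesis
    proof (cases "left_reduced D")
      case True
      then show ?thesis using base less.prems by blast
    next
      case False
      then obtain j t where t: "D (Lf j) = Some t" "\<And>a. t \<noteq> ToTop a" "\<And>k. t \<noteq> ToNode (Rt k)"
        unfolding left_reduced_def by blast
      then have "\<exists>b. t = ToBottom b"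
        using no_arc by (metis node.exhaust target.exhaust)
      then obtain b where b: "D (Lf n) = Some (ToBottom b)"
        using last_node_bottom[OF less.prems(1)] t no_arc by blast
      let ?D = "concat_diagram n (w_diag n b b) D"
      have w: "w_diag n b b \<in> generator_diagrams n" and v: "v_diag n b b \<in> generator_diagrams n"
        unfolding generator_diagrams_def by blast+
      have D': "?D \<in> diagrams n"
        using concat_diagrams less.prems(1) generator_diagrams_subset[OF n] w by blast
      note eq = bottom_to_top[OF D n b, of b b]
      have "P ?D" using P[OF v D'] eq less.prems(2) by simp
      then have "?D \<in> generated n" using IH[OF D'] eq by simp
      then show ?thesis using generated.concat[OF generated.base[OF v]] eq by metis
    qed
  qed
qed

section \<open>Fully reduced diagrams\<close>

text \<open>Up to labels this is the \<open>p\<close>-th power of \<open>w\<close>. The label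
  functions are indexed by the node at which the string starts.\<close>

definition normal :: "nat \<Rightarrow> nat \<Rightarrow> (nat \<Rightarrow> 'x) \<Rightarrow> (nat \<Rightarrow> 'x) \<Rightarrow> 'x diagram" where
  "normal n p a b = (\<lambda>q. if q \<in> nodes n then Some (case q of
       Lf j \<Rightarrow> if j \<le> p then ToTop (a j) else ToNode (Rt (j - p))
     | Rt j \<Rightarrow> if j + p \<le> n then ToNode (Lf (j + p)) else ToBottom (b j)) else None)"

lemma matching_normal: "p \<le> n \<Longrightarrow> matching n (normal n p a b)"
  unfolding matching_def
proof (intro conjI allI impI)
  show "dom (normal n p a b) = nodes n" by (simp add: normal_def dom_def)
  fix q r assume "normal n p a b q = Some (ToNode r)"
  then show "r \<noteq> q" "normal n p a b r = Some (ToNode q)"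
    by (cases q; auto simp: normal_def split: if_splits)+
qed

lemma normal_generated:
  assumes n: "n \<ge> 1" and "p \<le> n"
  shows "normal n p a b \<in> generated n"
  using assms(2)
proof (induction p arbitrary: a b)
  case 0
  have "normal n 0 a b = id_diag n"
    by (auto simp: normal_def id_diag_def fun_eq_iff split: node.splits)
  then show ?case using generated.base unfolding generator_diagrams_def by auto
next
  case (Suc p)
  \<comment> \<open>The string of \<open>w\<close> to the top takes node 1 and pushes the others
    down, hence \<open>a (j + 1)\<close>. Its string to the bottom is reached from right node
    \<open>n - p\<close>, just above the bottom strings of \<open>?N\<close>.\<close>
  let ?w = "w_diag n (a 1) (b (n - p))" and ?N = "normal n p (\<lambda>j. a (j + 1)) b"
  have w: "?w \<in> generator_diagrams n" unfolding generator_diagrams_def by blast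
  have mw: "matching n ?w" using w_diagram[OF n, of "a 1" "b (n - p)"] by (simp add: diagrams_iff)
  have mN: "matching n ?N" using Suc.prems by (intro matching_normal) simp
  interpret composable n ?w ?N using mw mN by unfold_locales
  have "concat_diagram n ?w ?N = normal n (Suc p) a b"
  proof (rule diagram_eqI[OF matching_concat matching_normal[OF Suc.prems]])
    fix j t assume t: "normal n (Suc p) a b (Lf j) = Some t"
    then have j: "1 \<le> j" "j \<le> n" by (auto simp: normal_def split: if_splits)
    have "concat_diagram n ?w ?N (Lf j) = Some t"
    proof (cases "j = 1")
      case True
      then show ?thesis
        by (intro concat_Lf_own) (use t n in \<open>auto simp: w_diag_def normal_def\<close>)
    next
      case False
      have "leads (Inr (Lf (j - 1))) t"
        by (rule leads_right_stop) (use t j False in \<open>auto simp: normal_def split: if_splits\<close>)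
      then show ?thesis
        by (rule concat_Lf_step[rotated]) (use j False in \<open>auto simp: w_diag_def\<close>)
    qed
    then show "concat_diagram n ?w ?N (Lf j) = Some t \<or>
      (\<exists>m. t = ToNode (Lf m) \<and> concat_diagram n ?w ?N (Lf m) = Some (ToNode (Lf j)))" ..
  next
    fix j t assume t: "normal n (Suc p) a b (Rt j) = Some t" "\<And>k. t \<noteq> ToNode (Lf k)"
    then have j: "1 \<le> j" "j \<le> n" "t = ToBottom (b j)" "n < j + Suc p"
      by (auto simp: normal_def split: if_splits)
    show "concat_diagram n ?w ?N (Rt j) = Some t"
    proof (cases "j + p = n")
      case True
      have "leads (Inl (Rt n)) t"
        by (rule leads_left_stop) (use True j n in \<open>auto simp: w_diag_def\<close>)
      then have "leads (Inr (Rt j)) t"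
        by (rule leads_right_step[rotated]) (use True j in \<open>auto simp: normal_def\<close>)
      then show ?thesis using concat_leads[of "Rt j"] j by simp
    next
      case False
      then show ?thesis
        by (intro concat_Rt_own) (use j in \<open>auto simp: normal_def\<close>)
    qed
  qed
  moreover have "?N \<in> generated n" using Suc by simp
  ultimately show ?case using generated.concat[OF generated.base[OF w]] by metis
qed

lemma reduced_normal:
  fixes D :: "'x diagram"
  assumes diag: "D \<in> diagrams n" and L: "left_reduced D" and R: "right_reduced D"
  shows "\<exists>p a b. p \<le> n \<and> D = normal n p a b"
proof -
  have D: "matching n D" and nc: "noncrossing n D" using diag by (auto simp: diagrams_iff)
  define p where "p = Max (insert 0 (tops n D))"
  \<comment> \<open>A through string starting above \<open>j\<close> would cross the string from
    \<open>j\<close> to the top.\<close>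
  have tops_down: "i \<in> tops n D" if j: "j \<in> tops n D" and i: "1 \<le> i" "i < j" for i j
  proof -
    obtain a where a: "1 \<le> j" "j \<le> n" "D (Lf j) = Some (ToTop a)" using j by (auto simp: tops_def)
    obtain t where t: "D (Lf i) = Some t" using matchingD(5)[OF D, of "Lf i"] a i by auto
    have "t \<noteq> ToNode (Rt k)" for k
    proof
      assume k: "t = ToNode (Rt k)"
      then have "k \<le> n" using matchingD(4)[OF D, of "Lf i" "Rt k"] t by simp
      then have "j < 2 * n + 2 - k" using a by linarith
      then show False
        using noncrossing_strings[OF nc a(3) t, of 0 j i "2 * n + 2 - k"] a i k
        by (auto simp: doubleton_eq_iff)
    qed
    then show ?thesis using L t i a unfolding left_reduced_def tops_def by fastforce
  qed
  have pn: "p \<le> n" unfolding p_def by (auto simp: tops_def)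
  have le_p: "j \<in> tops n D \<longleftrightarrow> 1 \<le> j \<and> j \<le> p" for j
  proof
    assume "j \<in> tops n D"
    then show "1 \<le> j \<and> j \<le> p" unfolding p_def by (auto simp: tops_def)
  next
    assume j: "1 \<le> j \<and> j \<le> p"
    then have "p \<in> tops n D" using Max_in[of "insert 0 (tops n D)"] unfolding p_def by auto
    then show "j \<in> tops n D" using tops_down[of p j] j by (cases "j = p") auto
  qed
  have through: "\<exists>k. D (Lf j) = Some (ToNode (Rt k)) \<and> 1 \<le> k \<and> k \<le> n" if j: "p < j" "j \<le> n" for j
  proof -
    obtain t where t: "D (Lf j) = Some t" using matchingD(5)[OF D, of "Lf j"] j by auto
    have "j \<notin> tops n D" using le_p j by auto
    then have "t \<noteq> ToTop a" for a using t j by (auto simp: tops_def)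
    then obtain k where "t = ToNode (Rt k)" using L t unfolding left_reduced_def by blast
    then show ?thesis using t matchingD(4)[OF D, of "Lf j" "Rt k"] by auto
  qed
  have not_top: "p < j \<and> j \<le> n" if "D (Lf j) = Some (ToNode q)" for j q
    using le_p[of j] that matchingD(3)[OF D that] by (auto simp: tops_def)
  \<comment> \<open>Through strings keep their order. So the left nodes strictly between
    \<open>p\<close> and \<open>j\<close> correspond to the right nodes above \<open>k\<close>, and
    counting both sides gives \<open>j - p - 1 = k - 1\<close>.\<close>
  have shift: "j = k + p" if jk: "D (Lf j) = Some (ToNode (Rt k))" for j k
  proof -
    have k: "1 \<le> k" "k \<le> n" using matchingD(4)[OF D jk] by auto
    have kj: "D (Rt k) = Some (ToNode (Lf j))" using matchingD(1)[OF D jk] .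
    have j: "p < j" "j \<le> n" using not_top[OF jk] by auto
    define f where "f i = (case D (Lf i) of Some (ToNode (Rt m)) \<Rightarrow> m | _ \<Rightarrow> 0)" for i
    define g where "g m = (case D (Rt m) of Some (ToNode (Lf i)) \<Rightarrow> i | _ \<Rightarrow> 0)" for m
    have f: "f i \<in> {1..<k} \<and> g (f i) = i" if i: "i \<in> {p<..<j}" for i
    proof -
      obtain m where m: "D (Lf i) = Some (ToNode (Rt m))" "1 \<le> m" "m \<le> n" using through i j by fastforce
      have mi: "D (Rt m) = Some (ToNode (Lf i))" using matchingD(1)[OF D m(1)] .
      have "m \<noteq> k" using mi kj i by auto
      moreover have "j < 2 * n + 2 - m" "k < m \<Longrightarrow> 2 * n + 2 - m < 2 * n + 2 - k"
        using m j by linarith+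
      then have "\<not> k < m"
        using noncrossing_strings[OF nc m(1) jk, of i "2 * n + 2 - m" j "2 * n + 2 - k"] i j k m by auto
      ultimately show ?thesis using m mi by (auto simp: f_def g_def)
    qed
    have g: "g m \<in> {p<..<j} \<and> f (g m) = m" if m: "m \<in> {1..<k}" for m
    proof -
      obtain t where t: "D (Rt m) = Some t" using matchingD(5)[OF D, of "Rt m"] m k by auto
      have "n + 1 < 2 * n + 2 - k" "2 * n + 2 - k < 2 * n + 2 - m" using k m by auto
      note ineq = this
      \<comment> \<open>A string from right node \<open>m\<close> above \<open>k\<close> to the
        bottom would cross the string joining \<open>j\<close> and \<open>k\<close>; by
        \<open>R\<close> only a left partner remains.\<close>
      have "t \<noteq> ToBottom b" for b
        using ineq noncrossing_strings[OF nc jk t, of j "2 * n + 2 - k" "n + 1" "2 * n + 2 - m"] j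
        by (auto simp: insert_commute)
      then obtain i where i: "t = ToNode (Lf i)" using R t unfolding right_reduced_def by blast
      then have im: "D (Lf i) = Some (ToNode (Rt m))" using matchingD(1)[OF D] t by blast
      have "i \<noteq> j" using im jk m by auto
      moreover have "i < 2 * n + 2 - k" if "i \<le> n" using that k by linarith
      then have "\<not> j < i"
        using ineq noncrossing_strings[OF nc jk im, of j "2 * n + 2 - k" i "2 * n + 2 - m"] not_top[OF im] j k m
        by auto
      ultimately show ?thesis using not_top[OF im] t i im by (auto simp: f_def g_def)
    qed
    have "bij_betw f {p<..<j} {1..<k}"
      by (rule bij_betw_byWitness[where f' = g]) (use f g in blast)+
    then have "card {p<..<j} = card {1..<k}" by (rule bij_betw_same_card)
    then show ?thesis using j k by auto
  qed
  obtain a where a: "\<And>j c. D (Lf j) = Some (ToTop c) \<Longrightarrow> a j = c"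
  proof
    show "(case D (Lf j) of Some (ToTop c) \<Rightarrow> c | _ \<Rightarrow> undefined) = c"
      if "D (Lf j) = Some (ToTop c)" for j c using that by simp
  qed
  obtain b where b: "\<And>j c. D (Rt j) = Some (ToBottom c) \<Longrightarrow> b j = c"
  proof
    show "(case D (Rt j) of Some (ToBottom c) \<Rightarrow> c | _ \<Rightarrow> undefined) = c"
      if "D (Rt j) = Some (ToBottom c)" for j c using that by simp
  qed
  have "normal n p a b = D"
  proof (rule diagram_eqI[OF matching_normal[OF pn] D])
    fix j t assume t: "D (Lf j) = Some t"
    then have j: "1 \<le> j" "j \<le> n" using matchingD(3)[OF D t] by auto
    have "normal n p a b (Lf j) = Some t"
    proof (cases "j \<le> p")
      case True
      then have "j \<in> tops n D" using le_p j by blast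
      then obtain c where "D (Lf j) = Some (ToTop c)" by (auto simp: tops_def)
      then show ?thesis using a True t j by (simp add: normal_def)
    next
      case False
      then obtain k where "D (Lf j) = Some (ToNode (Rt k))" using through[of j] j by auto
      then show ?thesis using shift[of j k] t j False by (auto simp: normal_def)
    qed
    then show "normal n p a b (Lf j) = Some t \<or>
      (\<exists>m. t = ToNode (Lf m) \<and> normal n p a b (Lf m) = Some (ToNode (Lf j)))" ..
  next
    fix j t assume t: "D (Rt j) = Some t" "\<And>k. t \<noteq> ToNode (Lf k)"
    have j: "1 \<le> j" "j \<le> n" using matchingD(3)[OF D t(1)] by auto
    obtain c where c: "t = ToBottom c" using R t unfolding right_reduced_def by blast
    \<comment> \<open>Otherwise left node \<open>j + p\<close> is a through node, and by
      \<open>shift\<close> its partner is right node \<open>j\<close>.\<close>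
    have "\<not> j + p \<le> n"
    proof
      assume "j + p \<le> n"
      then obtain k where k: "D (Lf (j + p)) = Some (ToNode (Rt k))" using through[of "j + p"] j by auto
      then have "k = j" using shift[OF k] by simp
      then show False using matchingD(1)[OF D k] t by auto
    qed
    then show "normal n p a b (Rt j) = Some t" using b[of j c] t c j by (simp add: normal_def)
  qed
  then show ?thesis using pn by blast
qed

text \<open>\<open>left_reduction\<close> serves twice: for \<open>D\<close> itself, and for the
  half turn of a left reduced diagram, whose right side is reduced and stays so by
  \<open>P = right_reduced\<close>.\<close>

lemma diagrams_generated:
  assumes n: "n \<ge> 1"
  shows "generated n = diagrams n"
proof (intro equalityI generated_subset[OF n] subsetI)
  have right: "D \<in> generated n" if "D \<in> diagrams n" "right_reduced D" for D :: "'a diagram"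
  proof (rule left_reduction[where P = right_reduced, OF n _ _ that])
    show "right_reduced E" if "g \<in> generator_diagrams n" "E \<in> diagrams n"
      "right_reduced (concat_diagram n g E)" for g E :: "'a diagram"
      using that right_reduced_factor generator_diagrams_subset[OF n] diagrams_iff by blast
    show "E \<in> generated n" if "E \<in> diagrams n" "right_reduced E" "left_reduced E" for E :: "'a diagram"
      using reduced_normal[OF that(1,3,2)] normal_generated[OF n] by blast
  qed
  fix D :: "'a diagram" assume D: "D \<in> diagrams n"
  show "D \<in> generated n"
  proof (rule left_reduction[where P = "\<lambda>_. True", OF n _ _ D])
    fix E :: "'a diagram" assume E: "E \<in> diagrams n" "left_reduced E"
    have "right_reduced (rot n E)"
      unfolding right_reduced_def
    proof (intro allI impI)
      fix j t assume "rot n E (Rt j) = Some t"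
      then obtain s where s: "E (rot_node n (Rt j)) = Some s" "t = rot_target n s"
        using rot_SomeE by blast
      then show "(\<exists>b. t = ToBottom b) \<or> (\<exists>k. t = ToNode (Lf k))"
        using E(2) unfolding left_reduced_def by fastforce
    qed
    then have "rot n (rot n E) \<in> generated n"
      using right rot_diagrams E(1) rot_generated[OF n] by blast
    then show "E \<in> generated n" using rot_rot E(1) by (metis diagrams_iff)
  qed simp_all
qed

section \<open>The algebra\<close>

lemma indet_nonzero: "indet p \<noteq> 0"
proof -
  have "Poly_Mapping.single k (1 :: 'b :: zero_neq_one) \<noteq> 0" for k :: 'c
    by (metis lookup_single_eq lookup_zero one_neq_zero)
  then show ?thesis by (simp add: indet_def Zero_fract_def eq_fract)
qed

text \<open>A product over an infinite set is 1 by convention, so it is nonzero in either case of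
  \<open>finite A\<close>.\<close>

lemma concat_factor_nonzero: "concat_factor n D E \<noteq> 0"
proof -
  have "(\<Prod>(u, v, p)\<in>A. indet p) \<noteq> 0" for A :: "(vertex \<times> vertex \<times> 'a param) set"
    by (cases "finite A") (auto simp: indet_nonzero)
  then show ?thesis by (simp add: concat_factor_def indet_nonzero)
qed

text \<open>The substance is closure under products, which is planarity of concatenated
  diagrams.\<close>

lemma label_subalgebra_label_algebra: "label_subalgebra n (label_algebra n)"
  unfolding label_subalgebra_def
proof (intro conjI ballI allI)
  show add: "f + g \<in> label_algebra n" if "f \<in> label_algebra n" "g \<in> label_algebra n"
    for f g :: "'a diagram \<Rightarrow>\<^sub>0 'a ratfun"
    using that Poly_Mapping.keys_add[of f g] unfolding label_algebra_def by blast
  show zero: "0 \<in> label_algebra n" by (simp add: label_algebra_def)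
  show "label_scale c f \<in> label_algebra n" if "f \<in> label_algebra n" for c f
    using that unfolding label_algebra_def label_scale_def
    by (fastforce simp: in_keys_iff Poly_Mapping.map.rep_eq when_def split: if_splits)
  have sum: "(\<Sum>x\<in>A. F x) \<in> label_algebra n" if "\<And>x. x \<in> A \<Longrightarrow> F x \<in> label_algebra n"
    for A :: "'a diagram set" and F :: "'a diagram \<Rightarrow> 'a diagram \<Rightarrow>\<^sub>0 'a ratfun"
    using that by (induction A rule: infinite_finite_induct) (auto simp: zero intro: add)
  show "label_mult n f g \<in> label_algebra n" if "f \<in> label_algebra n" "g \<in> label_algebra n"
    for f g :: "'a diagram \<Rightarrow>\<^sub>0 'a ratfun"
    unfolding label_mult_def
  proof (intro sum)
    fix D E assume "D \<in> Poly_Mapping.keys f" "E \<in> Poly_Mapping.keys g"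
    then have "concat_diagram n D E \<in> diagrams n"
      using that concat_diagrams unfolding label_algebra_def by blast
    then show "Poly_Mapping.single (concat_diagram n D E)
        (Poly_Mapping.lookup f D * Poly_Mapping.lookup g E * concat_factor n D E) \<in> label_algebra n"
      unfolding label_algebra_def by auto
  qed
qed simp

lemma label_scale_single: "label_scale c (Poly_Mapping.single D d) = Poly_Mapping.single D (c * d)"
  by (simp add: label_scale_def)

text \<open>The product of two basis elements is a basis element times its factor, and a subalgebra
  is closed under scaling by the inverse of that factor.\<close>

lemma basis_elt_generated:
  assumes S: "label_subalgebra n S" and gens: "basis_elt ` generator_diagrams n \<subseteq> S"
    and D: "D \<in> generated n"
  shows "basis_elt D \<in> S"
  using D
proof induction
  case (base g)
  then show ?case using gens by blast
next
  case (concat D E)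
  let ?c = "concat_factor n D E"
  have "label_mult n (basis_elt D) (basis_elt E) = Poly_Mapping.single (concat_diagram n D E) ?c"
    by (simp add: label_mult_def basis_elt_def)
  then have "label_scale (inverse ?c) (Poly_Mapping.single (concat_diagram n D E) ?c) \<in> S"
    using S concat.IH unfolding label_subalgebra_def by metis
  then show ?case
    by (simp add: label_scale_single concat_factor_nonzero basis_elt_def)
qed

lemma label_algebra_subset:
  assumes S: "label_subalgebra n S" and basis: "basis_elt ` diagrams n \<subseteq> S"
  shows "label_algebra n \<subseteq> S"
proof
  fix f :: "'a diagram \<Rightarrow>\<^sub>0 'a ratfun"
  assume f: "f \<in> label_algebra n"
  have "f = (\<Sum>D\<in>Poly_Mapping.keys f. Poly_Mapping.single D (Poly_Mapping.lookup f D))"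
    by (rule poly_mapping_eqI) (simp add: lookup_sum lookup_single when_def in_keys_iff)
  moreover have "Poly_Mapping.single D (Poly_Mapping.lookup f D) \<in> S" if "D \<in> Poly_Mapping.keys f" for D
  proof -
    have "basis_elt D \<in> S" using that f basis unfolding label_algebra_def by blast
    then have "label_scale (Poly_Mapping.lookup f D) (basis_elt D) \<in> S" using S unfolding label_subalgebra_def by blast
    then show ?thesis by (simp add: basis_elt_def label_scale_single)
  qed
  moreover have "(\<Sum>x\<in>A. F x) \<in> S" if "\<And>x. x \<in> A \<Longrightarrow> F x \<in> S" for A :: "'a diagram set" and F
    using that S unfolding label_subalgebra_def
    by (induction A rule: infinite_finite_induct) auto
  ultimately show "f \<in> S" by metis
qed

theorem theorem3p3:
  fixes n :: nat
  assumes "n \<ge> 1"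
  shows "label_subalgebra n hull (basis_elt ` generator_diagrams n) =
         (label_algebra n :: ('x diagram \<Rightarrow>\<^sub>0 'x ratfun) set)"
proof (rule hull_unique)
  show "basis_elt ` generator_diagrams n \<subseteq> (label_algebra n :: ('x diagram \<Rightarrow>\<^sub>0 'x ratfun) set)"
    using generator_diagrams_subset[OF assms] by (auto simp: label_algebra_def basis_elt_def)
  show "label_subalgebra n (label_algebra n)" by (rule label_subalgebra_label_algebra)
  show "label_algebra n \<subseteq> S"
    if "basis_elt ` generator_diagrams n \<subseteq> S" "label_subalgebra n S"
    for S :: "('x diagram \<Rightarrow>\<^sub>0 'x ratfun) set"
    using label_algebra_subset[OF that(2)] basis_elt_generated[OF that(2,1)]
      diagrams_generated[OF assms] by blast
qed

end
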